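(* Let $\alpha>0$ and let $\mu,\nu\in\mathcal{P}_1(\mathbb{R}^{dT})$ have $\alpha$-linear conditional moments. Then $$\mathcal{AW}_1(\mu,\nu)\le\big((3+4\alpha)^T-1\big)\,\mathrm{TV}_1(\mu,\nu).$$
   Context: $d\ge1$ and $T\ge1$ are integers. Points of $\mathbb{R}^{dT}$ are paths $x=x_{1:T}=(x_1,\dots,x_T)$ with $x_t\in\mathbb{R}^d$; $x_{1:t}=(x_1,\dots,x_t)\in\mathbb{R}^{dt}$, and $\mathbb{R}^{dt}$ carries the norm $\|x_{1:t}\|=\sum_{s=1}^t\|x_s\|_{\mathbb{R}^d}$ (Euclidean norm on $\mathbb{R}^d$). $\mathcal{P}_1(\mathbb{R}^{dT})$ is the set of Borel probability measures with finite first moment. $\mu_{x_{1:t}}\in\mathcal{P}(\mathbb{R}^d)$ is the disintegration kernel of $\mu$ (conditional law of $x_{t+1}$ given $x_{1:t}$); analogously $\pi_{x_{1:t},y_{1:t}}$ is the conditional law of $(x_{t+1},y_{t+1})$ given $(x_{1:t},y_{1:t})$ under $\pi\in\mathcal{P}(\mathbb{R}^{dT}\times\mathbb{R}^{dT})$. $\mathrm{Cpl}(\mu,\nu)$ is the set of couplings of $\mu,\nu$. $\mathrm{Cpl}_{\mathrm{bc}}(\mu,\nu)$, the set of bi-causal couplings, consists of those $\pi\in\mathrm{Cpl}(\mu,\nu)$ with $\pi_{x_{1:t},y_{1:t}}\in\mathrm{Cpl}(\mu_{x_{1:t}},\nu_{y_{1:t}})$ for $\pi$-a.e. $(x,y)$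 and all $t=1,\dots,T-1$. The adapted Wasserstein distance is $\mathcal{AW}_1(\mu,\nu)=\inf_{\pi\in\mathrm{Cpl}_{\mathrm{bc}}(\mu,\nu)}\int\|x-y\|\,\pi(dx,dy)$. The weighted total variation distance is $\mathrm{TV}_1(\mu,\nu)=\int(\|x\|+\frac12)\,|\mu-\nu|(dx)=\inf_{\pi\in\mathrm{Cpl}(\mu,\nu)}\int(\|x\|+\|y\|+1)\mathbf{1}_{\{x\ne y\}}\,\pi(dx,dy)$, where $|\mu-\nu|=\mu+\nu-2(\mu\wedge\nu)$ and $\mu\wedge\nu=\mu-(\mu-\nu)^+$. $\mu$ has $\alpha$-linear conditional moments if for all $t=1,\dots,T-1$ and $x_{1:t}\in\mathbb{R}^{dt}$, $\int\|x_{t+1}\|\,\mu_{x_{1:t}}(dx_{t+1})\le\alpha(\|x_{1:t}\|+1)$. *)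

theory Defs
  imports "HOL-Probability.Probability"
begin

text \<open>
  A path \<open>x\<^sub>1, \<dots>, x\<^sub>t\<close> in \<open>\<real>\<^sup>d\<close> is a function on \<open>{1..t}\<close> (extensional, i.e. \<open>undefined\<close>
  outside \<open>{1..t}\<close>) with values in \<^typ>\<open>real ^ 'd\<close>; \<open>d \<ge> 1\<close> is the cardinality of \<open>'d\<close>. Since
  \<open>real ^ 'd\<close> is second countable, the product sigma-algebra is the Borel sigma-algebra
  of \<open>\<real>\<^sup>d\<^sup>t\<close>.
\<close>

definition paths :: "nat \<Rightarrow> (nat \<Rightarrow> real ^ 'd) measure" where
  "paths t = (\<Pi>\<^sub>M s\<in>{1..t}. borel)"

definition path_norm :: "nat \<Rightarrow> (nat \<Rightarrow> real ^ 'd) \<Rightarrow> real" where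
  "path_norm t x = (\<Sum>s=1..t. norm (x s))"

definition path_dist :: "nat \<Rightarrow> (nat \<Rightarrow> real ^ 'd) \<Rightarrow> (nat \<Rightarrow> real ^ 'd) \<Rightarrow> real" where
  "path_dist t x y = path_norm t (\<lambda>s. x s - y s)"

definition init :: "nat \<Rightarrow> (nat \<Rightarrow> real ^ 'd) \<Rightarrow> (nat \<Rightarrow> real ^ 'd)" where
  "init t x = restrict x {1..t}"

definition P1 :: "nat \<Rightarrow> (nat \<Rightarrow> real ^ 'd) measure set" where
  "P1 T = {\<mu> \<in> space (prob_algebra (paths T)). (\<integral>\<^sup>+ x. ennreal (path_norm T x) \<partial>\<mu>) < \<infinity>}"

text \<open>
  \<open>K\<close> is a version of the conditional law under \<open>M\<close> of \<open>Y\<close> (with values in \<open>L\<close>) given \<open>X\<close>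
  (with values in \<open>N\<close>). Versions agree only up to null sets of the law of \<open>X\<close>.
\<close>

definition is_cond_law ::
  "'w measure \<Rightarrow> 'a measure \<Rightarrow> ('w \<Rightarrow> 'a) \<Rightarrow> 'b measure \<Rightarrow> ('w \<Rightarrow> 'b) \<Rightarrow> ('a \<Rightarrow> 'b measure) \<Rightarrow> bool"
where
  "is_cond_law M N X L Y K \<longleftrightarrow>
     X \<in> M \<rightarrow>\<^sub>M N \<and> Y \<in> M \<rightarrow>\<^sub>M L \<and> K \<in> N \<rightarrow>\<^sub>M prob_algebra L \<and>
     (\<forall>A\<in>sets N. \<forall>B\<in>sets L.
        emeasure M {\<omega> \<in> space M. X \<omega> \<in> A \<and> Y \<omega> \<in> B} =
        (\<integral>\<^sup>+ x. emeasure (K x) B * indicator A x \<partial>distr M N X))"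

definition is_kernel ::
  "(nat \<Rightarrow> real ^ 'd) measure \<Rightarrow> nat \<Rightarrow> ((nat \<Rightarrow> real ^ 'd) \<Rightarrow> (real ^ 'd) measure) \<Rightarrow> bool" where
  "is_kernel \<mu> t K \<longleftrightarrow> is_cond_law \<mu> (paths t) (init t) borel (\<lambda>x. x (t + 1)) K"

definition is_kernel2 ::
  "((nat \<Rightarrow> real ^ 'd) \<times> (nat \<Rightarrow> real ^ 'd)) measure \<Rightarrow> nat \<Rightarrow>
   ((nat \<Rightarrow> real ^ 'd) \<times> (nat \<Rightarrow> real ^ 'd) \<Rightarrow> ((real ^ 'd) \<times> (real ^ 'd)) measure) \<Rightarrow> bool" where
  "is_kernel2 \<pi> t K \<longleftrightarrow>
     is_cond_law \<pi> (paths t \<Otimes>\<^sub>M paths t) (\<lambda>(x, y). (init t x, init t y))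
       (borel \<Otimes>\<^sub>M borel) (\<lambda>(x, y). (x (t + 1), y (t + 1))) K"

text \<open>
  The bound is required for every \<open>x\<close>, so it is a statement about some version of the
  disintegration. Equivalently, it holds almost everywhere for each version: on a null set a
  kernel may be replaced by the Dirac measure at \<open>0\<close>, which satisfies the bound.
\<close>

definition linear_cond_moments :: "real \<Rightarrow> nat \<Rightarrow> (nat \<Rightarrow> real ^ 'd) measure \<Rightarrow> bool" where
  "linear_cond_moments \<alpha> T \<mu> \<longleftrightarrow>
     (\<forall>t\<in>{1..<T}. \<exists>K. is_kernel \<mu> t K \<and>
        (\<forall>x\<in>space (paths t).
           (\<integral>\<^sup>+ v. ennreal (norm v) \<partial>K x) \<le> ennreal (\<alpha> * (path_norm t x + 1))))"

definition Cpl :: "'a measure \<Rightarrow> 'b measure \<Rightarrow> ('a \<times> 'b) measure set" where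
  "Cpl M N = {\<pi> \<in> space (prob_algebra (M \<Otimes>\<^sub>M N)). distr \<pi> M fst = M \<and> distr \<pi> N snd = N}"

text \<open>
  The almost-everywhere condition does not depend on the versions of the three kernels, since
  the marginals of \<open>\<pi>\<close> are \<open>\<mu>\<close> and \<open>\<nu>\<close>.
\<close>

definition Cpl_bc :: "nat \<Rightarrow> (nat \<Rightarrow> real ^ 'd) measure \<Rightarrow> (nat \<Rightarrow> real ^ 'd) measure \<Rightarrow>
    ((nat \<Rightarrow> real ^ 'd) \<times> (nat \<Rightarrow> real ^ 'd)) measure set" where
  "Cpl_bc T \<mu> \<nu> = {\<pi> \<in> Cpl \<mu> \<nu>. \<forall>t\<in>{1..<T}.
     \<exists>K\<^sub>\<mu> K\<^sub>\<nu> K\<^sub>\<pi>. is_kernel \<mu> t K\<^sub>\<mu> \<and> is_kernel \<nu> t K\<^sub>\<nu> \<and> is_kernel2 \<pi> t K\<^sub>\<pi> \<and>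
       (AE (x, y) in \<pi>. K\<^sub>\<pi> (init t x, init t y) \<in> Cpl (K\<^sub>\<mu> (init t x)) (K\<^sub>\<nu> (init t y)))}"

definition AW1 :: "nat \<Rightarrow> (nat \<Rightarrow> real ^ 'd) measure \<Rightarrow> (nat \<Rightarrow> real ^ 'd) measure \<Rightarrow> ennreal" where
  "AW1 T \<mu> \<nu> = (INF \<pi>\<in>Cpl_bc T \<mu> \<nu>. \<integral>\<^sup>+ (x, y). ennreal (path_dist T x y) \<partial>\<pi>)"

text \<open>
  Positive part of the Jordan decomposition of \<open>M - N\<close>, for finite measures on the same
  sigma-algebra. Subtraction in \<^typ>\<open>ennreal\<close> truncates at \<open>0\<close>, which does not change the supremum
  because \<open>B = {}\<close> is admitted.
\<close>

definition pos_part_diff :: "'a measure \<Rightarrow> 'a measure \<Rightarrow> 'a measure" where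
  "pos_part_diff M N = measure_of (space M) (sets M)
     (\<lambda>A. SUP B\<in>{B \<in> sets M. B \<subseteq> A}. emeasure M B - emeasure N B)"

definition meet_measure :: "'a measure \<Rightarrow> 'a measure \<Rightarrow> 'a measure" where
  "meet_measure M N = diff_measure M (pos_part_diff M N)"

definition abs_diff :: "'a measure \<Rightarrow> 'a measure \<Rightarrow> 'a measure" where
  "abs_diff M N = measure_of (space M) (sets M)
     (\<lambda>A. emeasure M A + emeasure N A - 2 * emeasure (meet_measure M N) A)"

definition TV1 :: "nat \<Rightarrow> (nat \<Rightarrow> real ^ 'd) measure \<Rightarrow> (nat \<Rightarrow> real ^ 'd) measure \<Rightarrow> ennreal" where
  "TV1 T \<mu> \<nu> = (\<integral>\<^sup>+ x. ennreal (path_norm T x + 1 / 2) \<partial>abs_diff \<mu> \<nu>)"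

text \<open>
  \<^const>\<open>measure_of\<close> yields the null measure when its argument is not countably additive. The
  following facts show that this does not happen here.
\<close>

lemma measure_split:
  assumes "finite_measure P" "A \<in> sets P" "B \<in> sets P"
  shows "measure P A = measure P (A \<inter> B) + measure P (A - B)"
proof -
  interpret finite_measure P by fact
  show ?thesis using finite_measure_Diff'[OF assms(2,3)] by simp
qed

lemma jordan_aux:
  assumes M: "finite_measure M" and N: "finite_measure N" and S: "sets N = sets M"
  obtains Y where "Y \<in> sets M"
    "\<And>A. A \<in> sets M \<Longrightarrow>
       (SUP B\<in>{B \<in> sets M. B \<subseteq> A}. emeasure M B - emeasure N B) = emeasure M (A \<inter> Y) - emeasure N (A \<inter> Y)"
    "\<And>A. A \<in> sets M \<Longrightarrow> emeasure N (A \<inter> Y) \<le> emeasure M (A \<inter> Y)"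
    "\<And>A. A \<in> sets M \<Longrightarrow> emeasure M (A - Y) \<le> emeasure N (A - Y)"
proof -
  interpret M: finite_measure M by fact
  interpret N: finite_measure N by fact
  obtain Y where Y: "Y \<in> sets M"
    and 1: "\<And>X. X \<in> sets M \<Longrightarrow> X \<subseteq> Y \<Longrightarrow> emeasure N X \<le> emeasure M X"
    and 2: "\<And>X. X \<in> sets M \<Longrightarrow> X \<inter> Y = {} \<Longrightarrow> emeasure M X \<le> emeasure N X"
    using finite_unsigned_Hahn_decomposition[OF M N S] by metis
  have "(SUP B\<in>{B \<in> sets M. B \<subseteq> A}. emeasure M B - emeasure N B) =
      emeasure M (A \<inter> Y) - emeasure N (A \<inter> Y)" if A: "A \<in> sets M" for A
  proof (rule antisym, rule SUP_least)
    fix B assume B: "B \<in> {B \<in> sets M. B \<subseteq> A}"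
    then have Bm: "B \<in> sets M" "B \<subseteq> A" by auto
    have s: "B \<inter> Y \<in> sets M" "B - Y \<in> sets M" "A \<inter> Y \<in> sets M" "A \<inter> Y - B \<in> sets M"
      using Bm A Y by auto
    have AYB: "A \<inter> Y \<inter> B = B \<inter> Y" using Bm by auto
    have "measure M B = measure M (B \<inter> Y) + measure M (B - Y)"
      "measure N B = measure N (B \<inter> Y) + measure N (B - Y)"
      "measure M (A \<inter> Y) = measure M (B \<inter> Y) + measure M (A \<inter> Y - B)"
      "measure N (A \<inter> Y) = measure N (B \<inter> Y) + measure N (A \<inter> Y - B)"
      using measure_split[OF M, of B Y] measure_split[OF N, of B Y]
        measure_split[OF M, of "A \<inter> Y" B] measure_split[OF N, of "A \<inter> Y" B] Bm(1) Y s(3) S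
      unfolding AYB by simp_all
    moreover have "measure M (B - Y) \<le> measure N (B - Y)"
      using 2[OF s(2)] by (auto simp: M.emeasure_eq_measure N.emeasure_eq_measure)
    moreover have "measure N (A \<inter> Y - B) \<le> measure M (A \<inter> Y - B)"
      using 1[OF s(4)] by (auto simp: M.emeasure_eq_measure N.emeasure_eq_measure)
    ultimately have "measure M B - measure N B \<le> measure M (A \<inter> Y) - measure N (A \<inter> Y)"
      by linarith
    then show "emeasure M B - emeasure N B \<le> emeasure M (A \<inter> Y) - emeasure N (A \<inter> Y)"
      by (simp only: M.emeasure_eq_measure N.emeasure_eq_measure ennreal_minus measure_nonneg ennreal_leI)
  next
    show "emeasure M (A \<inter> Y) - emeasure N (A \<inter> Y) \<le>
        (SUP B\<in>{B \<in> sets M. B \<subseteq> A}. emeasure M B - emeasure N B)"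
      using A Y by (intro SUP_upper) auto
  qed
  moreover have "emeasure N (A \<inter> Y) \<le> emeasure M (A \<inter> Y)" if "A \<in> sets M" for A
    using 1[of "A \<inter> Y"] that Y by auto
  moreover have "emeasure M (A - Y) \<le> emeasure N (A - Y)" if "A \<in> sets M" for A
    using 2[of "A - Y"] that Y by auto
  ultimately show ?thesis using that[OF Y] by simp
qed

lemma emeasure_measure_of_eq:
  assumes "sets P = sets M" "\<And>A. A \<in> sets M \<Longrightarrow> f A = emeasure P A" "A \<in> sets M"
  shows "emeasure (measure_of (space M) (sets M) f) A = f A"
proof -
  have "measure_of (space M) (sets M) f = measure_of (space M) (sets M) (emeasure P)"
    using assms(2) by (intro measure_of_eq) (auto simp: sets.space_closed sets.sigma_sets_eq)
  also have "\<dots> = P"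
    using measure_of_of_measure[of P] assms(1) sets_eq_imp_space_eq[OF assms(1)] by simp
  finally show ?thesis using assms by simp
qed

lemma emeasure_pos_part_diff:
  assumes M: "finite_measure M" and N: "finite_measure N" and S: "sets N = sets M"
    and A: "A \<in> sets M"
  shows "emeasure (pos_part_diff M N) A = (SUP B\<in>{B \<in> sets M. B \<subseteq> A}. emeasure M B - emeasure N B)"
proof -
  interpret M: finite_measure M by fact
  interpret N: finite_measure N by fact
  obtain Y where Y: "Y \<in> sets M"
    and eq: "\<And>A. A \<in> sets M \<Longrightarrow>
       (SUP B\<in>{B \<in> sets M. B \<subseteq> A}. emeasure M B - emeasure N B) = emeasure M (A \<inter> Y) - emeasure N (A \<inter> Y)"
    and le: "\<And>A. A \<in> sets M \<Longrightarrow> emeasure N (A \<inter> Y) \<le> emeasure M (A \<inter> Y)"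
    and ge: "\<And>A. A \<in> sets M \<Longrightarrow> emeasure M (A - Y) \<le> emeasure N (A - Y)"
    by (rule jordan_aux[OF M N S]) (rule that)
  let ?M = "density M (indicator Y)" and ?N = "density N (indicator Y)"
  have e: "emeasure ?M B = emeasure M (B \<inter> Y)" "emeasure ?N B = emeasure N (B \<inter> Y)"
    if "B \<in> sets M" for B
    using Y S that emeasure_restricted[of Y M B] emeasure_restricted[of Y N B]
    by (simp_all add: Int_commute)
  have "finite_measure ?M" "finite_measure ?N"
    using e[of "space M"] sets_eq_imp_space_eq[OF S] by (auto intro!: finite_measureI)
  then have "emeasure (diff_measure ?M ?N) B = emeasure M (B \<inter> Y) - emeasure N (B \<inter> Y)"
    if "B \<in> sets M" for B
    using that le S e by (subst emeasure_diff_measure) auto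
  then show ?thesis
    unfolding pos_part_diff_def using S A eq
    by (intro emeasure_measure_of_eq[where P="diff_measure ?M ?N"]) auto
qed

lemma sets_pos_part_diff [simp]: "sets (pos_part_diff M N) = sets M"
  by (simp add: pos_part_diff_def)

lemma sets_meet_measure [simp]: "sets (meet_measure M N) = sets M"
  by (simp add: meet_measure_def)

lemma pos_part_diff_le:
  assumes "finite_measure M" "finite_measure N" "sets N = sets M" "A \<in> sets M"
  shows "emeasure (pos_part_diff M N) A \<le> emeasure M A"
  unfolding emeasure_pos_part_diff[OF assms]
  by (rule SUP_least) (use assms in \<open>auto intro: order.trans[OF diff_le_self_ennreal] emeasure_mono\<close>)

lemma emeasure_meet_measure:
  assumes M: "finite_measure M" and N: "finite_measure N" and S: "sets N = sets M"
    and A: "A \<in> sets M"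
  shows "emeasure (meet_measure M N) A = emeasure M A - emeasure (pos_part_diff M N) A"
proof -
  interpret M: finite_measure M by fact
  have "space (pos_part_diff M N) = space M" by (rule sets_eq_imp_space_eq) simp
  then have "finite_measure (pos_part_diff M N)"
    using pos_part_diff_le[OF M N S sets.top]
    by (intro finite_measureI) (auto simp: M.emeasure_eq_measure top_unique)
  then show ?thesis
    unfolding meet_measure_def using pos_part_diff_le[OF M N S] A M
    by (subst emeasure_diff_measure) auto
qed

lemma emeasure_abs_diff:
  assumes M: "finite_measure M" and N: "finite_measure N" and S: "sets N = sets M"
    and A: "A \<in> sets M"
  shows "emeasure (abs_diff M N) A = emeasure M A + emeasure N A - 2 * emeasure (meet_measure M N) A"
proof -
  interpret M: finite_measure M by fact
  interpret N: finite_measure N by fact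
  obtain Y where Y: "Y \<in> sets M"
    and eq: "\<And>A. A \<in> sets M \<Longrightarrow>
       (SUP B\<in>{B \<in> sets M. B \<subseteq> A}. emeasure M B - emeasure N B) = emeasure M (A \<inter> Y) - emeasure N (A \<inter> Y)"
    and le: "\<And>A. A \<in> sets M \<Longrightarrow> emeasure N (A \<inter> Y) \<le> emeasure M (A \<inter> Y)"
    and ge: "\<And>A. A \<in> sets M \<Longrightarrow> emeasure M (A - Y) \<le> emeasure N (A - Y)"
    by (rule jordan_aux[OF M N S]) (rule that)
  define P where "P = measure_of (space M) (sets M)
    (\<lambda>B. emeasure (diff_measure M (meet_measure M N)) B + emeasure (diff_measure N (meet_measure M N)) B)"
  have meet: "emeasure (meet_measure M N) B = emeasure N (B \<inter> Y) + emeasure M (B - Y)"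
    if B: "B \<in> sets M" for B
  proof -
    have "measure M B = measure M (B \<inter> Y) + measure M (B - Y)"
      using measure_split[OF M B Y] .
    then show ?thesis
      unfolding emeasure_meet_measure[OF M N S B] emeasure_pos_part_diff[OF M N S B] eq[OF B]
      using le[OF B]
      by (simp add: M.emeasure_eq_measure N.emeasure_eq_measure ennreal_minus flip: ennreal_plus)
  qed
  have meetM: "emeasure (meet_measure M N) B \<le> emeasure M B" if B: "B \<in> sets M" for B
    unfolding emeasure_meet_measure[OF M N S B] by (rule diff_le_self_ennreal)
  have meetN: "emeasure (meet_measure M N) B \<le> emeasure N B" if B: "B \<in> sets M" for B
  proof -
    have "measure N B = measure N (B \<inter> Y) + measure N (B - Y)"
      using measure_split[OF N, of B Y] B Y S by simp
    then show ?thesis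
      using meet[OF B] ge[OF B]
      by (simp add: M.emeasure_eq_measure N.emeasure_eq_measure flip: ennreal_plus)
  qed
  have sp: "space (meet_measure M N) = space M" by (rule sets_eq_imp_space_eq) simp
  have fin: "finite_measure (meet_measure M N)"
    using meetM[OF sets.top] sp
    by (intro finite_measureI) (auto simp: M.emeasure_eq_measure top_unique)
  interpret I: finite_measure "meet_measure M N" by fact
  have dM: "emeasure (diff_measure M (meet_measure M N)) B = emeasure M B - emeasure (meet_measure M N) B"
    if "B \<in> sets M" for B
    using that meetM M fin by (subst emeasure_diff_measure) auto
  have dN: "emeasure (diff_measure N (meet_measure M N)) B = emeasure N B - emeasure (meet_measure M N) B"
    if "B \<in> sets M" for B
    using that meetN N fin S by (subst emeasure_diff_measure) auto
  have "countably_additive (sets M)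
    (\<lambda>B. emeasure (diff_measure M (meet_measure M N)) B + emeasure (diff_measure N (meet_measure M N)) B)"
    unfolding countably_additive_def
    using S by (auto simp: suminf_add[symmetric] suminf_emeasure)
  then have P: "emeasure P B = emeasure (diff_measure M (meet_measure M N)) B +
      emeasure (diff_measure N (meet_measure M N)) B" if "B \<in> sets M" for B
    unfolding P_def using that
    by (intro emeasure_measure_of_sigma) (auto simp: sets.sigma_algebra_axioms positive_def)
  show ?thesis
    unfolding abs_diff_def
  proof (rule emeasure_measure_of_eq[where P=P])
    fix B assume B: "B \<in> sets M"
    show "emeasure M B + emeasure N B - 2 * emeasure (meet_measure M N) B = emeasure P B"
      unfolding P[OF B] dM[OF B] dN[OF B] using meetM[OF B] meetN[OF B]
      by (simp add: M.emeasure_eq_measure N.emeasure_eq_measure I.emeasure_eq_measure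
          ennreal_minus flip: ennreal_plus ennreal_mult' ennreal_numeral)
  qed (use A in \<open>auto simp: P_def\<close>)
qed

end

theory Submission
  imports Defs
begin

text \<open>
  A bicausal coupling is built one time step at a time. While the two paths agree, the next values
  are drawn from a maximal coupling of the conditional laws \<open>\<mu>\<^sub>x\<close> and \<open>\<nu>\<^sub>x\<close>; once they have separated,
  the next values are drawn independently. Let \<open>D\<^sub>t\<close> be the expectation of
  \<open>(\<parallel>x\<parallel> + \<parallel>y\<parallel> + 1) 1\<^bsub>x \<noteq> y\<^esub>\<close> for the paths up to time \<open>t\<close>; it dominates the transport cost. The main point is
  \<open>D\<^bsub>t+1\<^esub> \<le> 2 (1 + 2 \<alpha>) D\<^sub>t + V\<^bsub>t+1\<^esub>\<close>,
  where \<open>V\<^sub>t\<close> is the weighted total variation distance of the laws up to time \<open>t\<close>.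

  Pairs that have separated before contribute at most \<open>(1 + 2 \<alpha>) D\<^sub>t\<close> by the moment condition. For
  pairs that separate at time \<open>t + 1\<close>, let \<open>\<eta>\<close> be the law of the common path up to time \<open>t\<close>; their
  contribution is \<open>\<integral> h d|\<eta> \<otimes> \<mu>\<^sub>x - \<eta> \<otimes> \<nu>\<^sub>x|\<close> with \<open>h (x, v) = \<parallel>x\<parallel> + \<parallel>v\<parallel> + 1/2\<close>. Since \<open>\<eta>\<close> is the law of \<open>x\<^bsub>1:t\<^esub>\<close>
  minus a part carried by separated pairs, this exceeds \<open>V\<^bsub>t+1\<^esub>\<close> by at most
  \<open>(1 + 2 \<alpha>) D\<^sub>t\<close> (\<open>off_diagonal_estimate\<close>). As \<open>V\<^sub>t \<le> V\<^bsub>t+1\<^esub>\<close> (\<open>TV1_init_le\<close>), induction gives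
  \<open>D\<^sub>T \<le> ((3 + 4 \<alpha>)\<^sup>T - 1) V\<^sub>T\<close>.

  The maximal couplings must depend measurably on \<open>x\<close> (\<open>maximal_kernel_coupling\<close>). To this end the
  Radon-Nikodym theorem is applied to the joint laws \<open>\<eta> \<otimes> \<mu>\<^sub>x\<close> and \<open>\<eta> \<otimes> \<nu>\<^sub>x\<close> with respect to their average
  rather than for each \<open>x\<close> separately; the resulting densities are jointly measurable, and for almost
  every \<open>x\<close> they are densities of \<open>\<mu>\<^sub>x\<close> and \<open>\<nu>\<^sub>x\<close>. The extension of a bicausal coupling by one step is
  \<open>Cpl_bc_extend\<close>.
\<close>

section \<open>Joint laws and conditional laws\<close>

text \<open>
  The law of \<open>(x, y)\<close> when \<open>x\<close> has law \<open>M\<close> and \<open>y\<close> has law \<open>K x\<close> given \<open>x\<close>. The sigma-algebra \<open>L\<close> of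
  the second component is an explicit argument, since \<open>K\<close> does not determine it. \<open>M\<close> need not have
  mass one.
\<close>

definition kernel_prod :: "'a measure \<Rightarrow> 'b measure \<Rightarrow> ('a \<Rightarrow> 'b measure) \<Rightarrow> ('a \<times> 'b) measure" where
  "kernel_prod M L K = M \<bind> (\<lambda>x. distr (K x) (M \<Otimes>\<^sub>M L) (Pair x))"

context
  fixes M :: "'a measure" and L :: "'b measure" and K
  assumes K: "K \<in> M \<rightarrow>\<^sub>M prob_algebra L"
begin

lemma kernel_prod_measurable: "(\<lambda>x. distr (K x) (M \<Otimes>\<^sub>M L) (Pair x)) \<in> M \<rightarrow>\<^sub>M prob_algebra (M \<Otimes>\<^sub>M L)"
  using K by (intro measurable_distr_prob_space2[where M=L]) auto

lemma sets_kernel_prod: "space M \<noteq> {} \<Longrightarrow> sets (kernel_prod M L K) = sets (M \<Otimes>\<^sub>M L)"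
  unfolding kernel_prod_def by (intro sets_bind) auto

lemma nn_integral_kernel_prod:
  assumes h: "h \<in> borel_measurable (M \<Otimes>\<^sub>M L)"
  shows "(\<integral>\<^sup>+z. h z \<partial>kernel_prod M L K) = (\<integral>\<^sup>+x. \<integral>\<^sup>+y. h (x, y) \<partial>K x \<partial>M)"
proof -
  have "(\<integral>\<^sup>+z. h z \<partial>kernel_prod M L K) = (\<integral>\<^sup>+x. \<integral>\<^sup>+z. h z \<partial>distr (K x) (M \<Otimes>\<^sub>M L) (Pair x) \<partial>M)"
    unfolding kernel_prod_def
    by (rule nn_integral_bind[OF h measurable_prob_algebraD[OF kernel_prod_measurable]])
  also have "\<dots> = (\<integral>\<^sup>+x. \<integral>\<^sup>+y. h (x, y) \<partial>K x \<partial>M)"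
  proof (rule nn_integral_cong)
    fix x assume x: "x \<in> space M"
    then have "Pair x \<in> K x \<rightarrow>\<^sub>M M \<Otimes>\<^sub>M L"
      unfolding subprob_measurableD(3)[OF measurable_prob_algebraD[OF K] x] by simp
    then show "(\<integral>\<^sup>+z. h z \<partial>distr (K x) (M \<Otimes>\<^sub>M L) (Pair x)) = (\<integral>\<^sup>+y. h (x, y) \<partial>K x)"
      using h by (simp add: nn_integral_distr)
  qed
  finally show ?thesis .
qed

lemma emeasure_kernel_prod_Times:
  assumes ne: "space M \<noteq> {}" and A: "A \<in> sets M" and B: "B \<in> sets L"
  shows "emeasure (kernel_prod M L K) (A \<times> B) = (\<integral>\<^sup>+x. emeasure (K x) B * indicator A x \<partial>M)"
proof -
  have AB: "A \<times> B \<in> sets (M \<Otimes>\<^sub>M L)" using A B by simp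
  have "emeasure (kernel_prod M L K) (A \<times> B) = (\<integral>\<^sup>+z. indicator (A \<times> B) z \<partial>kernel_prod M L K)"
    using AB by (simp add: sets_kernel_prod[OF ne])
  also have "\<dots> = (\<integral>\<^sup>+x. \<integral>\<^sup>+y. indicator (A \<times> B) (x, y) \<partial>K x \<partial>M)"
    using AB by (intro nn_integral_kernel_prod) simp
  also have "\<dots> = (\<integral>\<^sup>+x. emeasure (K x) B * indicator A x \<partial>M)"
  proof (rule nn_integral_cong)
    fix x assume x: "x \<in> space M"
    have "B \<in> sets (K x)" using B subprob_measurableD(2)[OF measurable_prob_algebraD[OF K] x] by simp
    then show "(\<integral>\<^sup>+y. indicator (A \<times> B) (x, y) \<partial>K x) = emeasure (K x) B * indicator A x"
      by (simp add: indicator_times nn_integral_cmult mult.commute)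
  qed
  finally show ?thesis .
qed

end

lemma is_cond_lawD:
  assumes "is_cond_law M N X L Y K"
  shows "X \<in> M \<rightarrow>\<^sub>M N" "Y \<in> M \<rightarrow>\<^sub>M L" "K \<in> N \<rightarrow>\<^sub>M prob_algebra L"
  using assms by (auto simp: is_cond_law_def)

text \<open>
  The defining property of a conditional law concerns rectangles \<open>A \<times> B\<close> only. These form a
  generator stable under intersection, so the property determines the joint law.
\<close>

lemma distr_eq_kernel_prod:
  assumes c: "is_cond_law M N X L Y K" and M: "prob_space M"
  shows "distr M (N \<Otimes>\<^sub>M L) (\<lambda>\<omega>. (X \<omega>, Y \<omega>)) = kernel_prod (distr M N X) L K"
proof -
  note [measurable] = is_cond_lawD[OF c]
  have K: "K \<in> distr M N X \<rightarrow>\<^sub>M prob_algebra L" by simp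
  interpret M: prob_space M by fact
  have ne: "space (distr M N X) \<noteq> {}"
    using M.not_empty measurable_space[OF is_cond_lawD(1)[OF c]] by auto
  have s: "sets (kernel_prod (distr M N X) L K) = sets (N \<Otimes>\<^sub>M L)"
    unfolding sets_kernel_prod[OF K ne] by (intro sets_pair_measure_cong) auto
  let ?E = "{a \<times> b |a b. a \<in> sets N \<and> b \<in> sets L}"
  show ?thesis
  proof (rule measure_eqI_generator_eq[where E="?E" and A="\<lambda>_. space N \<times> space L" and \<Omega>="space N \<times> space L"])
    show "Int_stable ?E" by (rule Int_stable_pair_measure_generator)
    show "?E \<subseteq> Pow (space N \<times> space L)" by (rule pair_measure_closed)
    fix Z assume "Z \<in> ?E"
    then obtain A B where Z: "Z = A \<times> B" "A \<in> sets N" "B \<in> sets L" by auto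
    have "emeasure (distr M (N \<Otimes>\<^sub>M L) (\<lambda>\<omega>. (X \<omega>, Y \<omega>))) Z = emeasure M {\<omega> \<in> space M. X \<omega> \<in> A \<and> Y \<omega> \<in> B}"
      unfolding Z(1) using Z(2,3) by (subst emeasure_distr) (auto intro!: arg_cong2[where f=emeasure])
    also have "\<dots> = emeasure (kernel_prod (distr M N X) L K) Z"
      unfolding Z(1) using c Z(2,3) by (subst emeasure_kernel_prod_Times[OF K ne]) (auto simp: is_cond_law_def)
    finally show "emeasure (distr M (N \<Otimes>\<^sub>M L) (\<lambda>\<omega>. (X \<omega>, Y \<omega>))) Z = emeasure (kernel_prod (distr M N X) L K) Z" .
  next
    show "emeasure (distr M (N \<Otimes>\<^sub>M L) (\<lambda>\<omega>. (X \<omega>, Y \<omega>))) (space N \<times> space L) \<noteq> \<infinity>" for i :: nat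
      by (subst emeasure_distr) auto
  qed (auto simp: s sets_pair_measure)
qed

lemma nn_integral_cond_law:
  assumes c: "is_cond_law M N X L Y K" and M: "prob_space M"
    and h[measurable]: "h \<in> borel_measurable (N \<Otimes>\<^sub>M L)"
  shows "(\<integral>\<^sup>+\<omega>. h (X \<omega>, Y \<omega>) \<partial>M) = (\<integral>\<^sup>+x. \<integral>\<^sup>+y. h (x, y) \<partial>K x \<partial>distr M N X)"
proof -
  note [measurable] = is_cond_lawD[OF c]
  have "(\<integral>\<^sup>+\<omega>. h (X \<omega>, Y \<omega>) \<partial>M) = (\<integral>\<^sup>+z. h z \<partial>distr M (N \<Otimes>\<^sub>M L) (\<lambda>\<omega>. (X \<omega>, Y \<omega>)))"
    by (subst nn_integral_distr) auto
  also have "\<dots> = (\<integral>\<^sup>+x. \<integral>\<^sup>+y. h (x, y) \<partial>K x \<partial>distr M N X)"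
    unfolding distr_eq_kernel_prod[OF c M] by (intro nn_integral_kernel_prod) auto
  finally show ?thesis .
qed

text \<open>
  Being a conditional law depends on the joint law of the two variables only, hence may be tested
  after pushing the underlying measure forward.
\<close>

lemma is_cond_law_distr:
  assumes \<phi>: "\<phi> \<in> M \<rightarrow>\<^sub>M M'" and X: "X \<in> M' \<rightarrow>\<^sub>M N" and Y: "Y \<in> M' \<rightarrow>\<^sub>M L"
    and X': "\<And>\<omega>. \<omega> \<in> space M \<Longrightarrow> X' \<omega> = X (\<phi> \<omega>)" and Y': "\<And>\<omega>. \<omega> \<in> space M \<Longrightarrow> Y' \<omega> = Y (\<phi> \<omega>)"
  shows "is_cond_law (distr M M' \<phi>) N X L Y K \<longleftrightarrow> is_cond_law M N X' L Y' K"
proof -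
  have "X' \<in> M \<rightarrow>\<^sub>M N" "Y' \<in> M \<rightarrow>\<^sub>M L"
    using measurable_compose[OF \<phi> X] measurable_compose[OF \<phi> Y] X' Y'
    by (auto cong: measurable_cong)
  moreover have "distr (distr M M' \<phi>) N X = distr M N X'"
    using X' by (simp add: distr_distr[OF X \<phi>] comp_def cong: distr_cong)
  moreover have "emeasure (distr M M' \<phi>) {\<omega> \<in> space (distr M M' \<phi>). X \<omega> \<in> A \<and> Y \<omega> \<in> B} =
      emeasure M {\<omega> \<in> space M. X' \<omega> \<in> A \<and> Y' \<omega> \<in> B}" if "A \<in> sets N" "B \<in> sets L" for A B
  proof -
    have "{\<omega> \<in> space M'. X \<omega> \<in> A \<and> Y \<omega> \<in> B} \<in> sets M'"
      using X Y that by measurable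
    then show ?thesis
      using X' Y' measurable_space[OF \<phi>] by (subst emeasure_distr[OF \<phi>]) (auto intro!: arg_cong2[where f=emeasure])
  qed
  ultimately show ?thesis
    using X Y unfolding is_cond_law_def by auto
qed

section \<open>The maximal coupling of two densities\<close>

text \<open>
  The maximal coupling of the probability measures \<open>f \<rho>\<close> and \<open>g \<rho>\<close>: the common part \<open>min f g\<close> is put
  on the diagonal, and the excesses \<open>f - g\<close> and \<open>g - f\<close> (differences in \<^typ>\<open>ennreal\<close>, which truncate
  at \<open>0\<close>) are coupled independently after division by their common mass. The Boolean component of
  the auxiliary space selects between the two parts; it allows both to be written as one density. If
  the common mass is \<open>0\<close>, the second part vanishes because \<open>0 * \<infinity> = 0\<close> in \<^typ>\<open>ennreal\<close>.
\<close>

definition dens_coupling :: "'b measure \<Rightarrow> ('b \<Rightarrow> ennreal) \<Rightarrow> ('b \<Rightarrow> ennreal) \<Rightarrow> ('b \<times> 'b) measure" where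
  "dens_coupling \<rho> f g =
     distr (density (\<rho> \<Otimes>\<^sub>M (\<rho> \<Otimes>\<^sub>M count_space (UNIV :: bool set)))
         (\<lambda>(u, v, b). if b then min (f u) (g u)
            else (f u - g u) * (g v - f v) / (\<integral>\<^sup>+ w. f w - g w \<partial>\<rho>)))
       (\<rho> \<Otimes>\<^sub>M \<rho>) (\<lambda>(u, v, b). (u, if b then u else v))"

lemma nn_integral_dens_coupling:
  assumes \<rho>: "prob_space \<rho>" and f[measurable]: "f \<in> borel_measurable \<rho>" and g[measurable]: "g \<in> borel_measurable \<rho>"
    and H[measurable]: "H \<in> borel_measurable (\<rho> \<Otimes>\<^sub>M \<rho>)"
  shows "(\<integral>\<^sup>+z. H z \<partial>dens_coupling \<rho> f g) =
    (\<integral>\<^sup>+u. (min (f u) (g u) * H (u, u) +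
       (\<integral>\<^sup>+v. (f u - g u) * (g v - f v) / (\<integral>\<^sup>+ w. f w - g w \<partial>\<rho>) * H (u, v) \<partial>\<rho>)) \<partial>\<rho>)"
proof -
  interpret prob_space \<rho> by fact
  let ?m = "\<integral>\<^sup>+ w. f w - g w \<partial>\<rho>"
  let ?B = "count_space (UNIV :: bool set)"
  interpret B: sigma_finite_measure ?B by (rule sigma_finite_measure_count_space_finite) simp
  interpret RB: pair_sigma_finite \<rho> ?B ..
  have [measurable]: "(\<lambda>p::'a \<times> 'a \<times> bool. snd (snd p)) \<in> \<rho> \<Otimes>\<^sub>M (\<rho> \<Otimes>\<^sub>M ?B) \<rightarrow>\<^sub>M ?B" by measurable
  have "(\<integral>\<^sup>+z. H z \<partial>dens_coupling \<rho> f g) = (\<integral>\<^sup>+p. (if snd (snd p) then min (f (fst p)) (g (fst p))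
            else (f (fst p) - g (fst p)) * (g (fst (snd p)) - f (fst (snd p))) / ?m) * H (fst p, if snd (snd p) then fst p else fst (snd p))
       \<partial>(\<rho> \<Otimes>\<^sub>M (\<rho> \<Otimes>\<^sub>M ?B)))"
    unfolding dens_coupling_def by (simp add: nn_integral_distr nn_integral_density split_beta')
  also have "\<dots> = (\<integral>\<^sup>+u. \<integral>\<^sup>+v. \<integral>\<^sup>+b. (if b then min (f u) (g u)
            else (f u - g u) * (g v - f v) / ?m) * H (u, if b then u else v) \<partial>?B \<partial>\<rho> \<partial>\<rho>)"
  proof -
    let ?G = "\<lambda>p. (if snd (snd p) then min (f (fst p)) (g (fst p))
            else (f (fst p) - g (fst p)) * (g (fst (snd p)) - f (fst (snd p))) / ?m) * H (fst p, if snd (snd p) then fst p else fst (snd p))"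
    have G[measurable]: "?G \<in> borel_measurable (\<rho> \<Otimes>\<^sub>M (\<rho> \<Otimes>\<^sub>M ?B))" by measurable
    have "(\<integral>\<^sup>+p. ?G p \<partial>(\<rho> \<Otimes>\<^sub>M (\<rho> \<Otimes>\<^sub>M ?B))) = (\<integral>\<^sup>+u. \<integral>\<^sup>+q. ?G (u, q) \<partial>(\<rho> \<Otimes>\<^sub>M ?B) \<partial>\<rho>)"
      by (rule RB.P.nn_integral_fst[symmetric, OF G])
    also have "\<dots> = (\<integral>\<^sup>+u. \<integral>\<^sup>+v. \<integral>\<^sup>+b. ?G (u, v, b) \<partial>?B \<partial>\<rho> \<partial>\<rho>)"
    proof (rule nn_integral_cong)
      fix u assume [simp]: "u \<in> space \<rho>"
      have "(\<lambda>q. ?G (u, q)) \<in> borel_measurable (\<rho> \<Otimes>\<^sub>M ?B)"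
        by (rule measurable_compose[OF _ G]) simp
      then show "(\<integral>\<^sup>+q. ?G (u, q) \<partial>(\<rho> \<Otimes>\<^sub>M ?B)) = (\<integral>\<^sup>+v. \<integral>\<^sup>+b. ?G (u, v, b) \<partial>?B \<partial>\<rho>)"
        by (rule B.nn_integral_fst[symmetric])
    qed
    finally show ?thesis by (simp only: fst_conv snd_conv)
  qed
  also have "\<dots> = (\<integral>\<^sup>+u. \<integral>\<^sup>+v. min (f u) (g u) * H (u, u) + (f u - g u) * (g v - f v) / ?m * H (u, v) \<partial>\<rho> \<partial>\<rho>)"
    by (simp add: nn_integral_count_space_finite UNIV_bool add.commute)
  also have "\<dots> = (\<integral>\<^sup>+u. (min (f u) (g u) * H (u, u) + (\<integral>\<^sup>+v. (f u - g u) * (g v - f v) / ?m * H (u, v) \<partial>\<rho>)) \<partial>\<rho>)"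
    by (intro nn_integral_cong, subst nn_integral_add) (auto simp: emeasure_space_1)
  finally show ?thesis .
qed

lemma min_plus_diff_ennreal: "min a b + (a - b) = (a :: ennreal)"
  by (cases "a \<le> b") (auto simp: min_def diff_add_cancel_ennreal diff_eq_0_iff_ennreal add.commute less_top[symmetric] top_unique)

text \<open>
  Two probability densities exceed each other by the same mass.
\<close>

lemma nn_integral_excess_eq:
  assumes [measurable]: "f \<in> borel_measurable \<rho>" "g \<in> borel_measurable \<rho>"
    and f1: "(\<integral>\<^sup>+u. f u \<partial>\<rho>) = 1" and g1: "(\<integral>\<^sup>+u. g u \<partial>\<rho>) = 1"
  shows "(\<integral>\<^sup>+u. g u - f u \<partial>\<rho>) = (\<integral>\<^sup>+u. f u - g u \<partial>\<rho>)" "(\<integral>\<^sup>+u. f u - g u \<partial>\<rho>) \<le> 1"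
proof -
  let ?c = "\<integral>\<^sup>+u. min (f u) (g u) \<partial>\<rho>"
  have a: "?c + (\<integral>\<^sup>+u. f u - g u \<partial>\<rho>) = 1"
    by (subst nn_integral_add[symmetric]) (auto simp: min_plus_diff_ennreal f1)
  have b: "?c + (\<integral>\<^sup>+u. g u - f u \<partial>\<rho>) = 1"
    by (subst nn_integral_add[symmetric]) (auto simp: min_plus_diff_ennreal g1 min.commute[of "f _"])
  have "?c \<noteq> \<top>" using a by (auto simp: top_add)
  then show "(\<integral>\<^sup>+u. g u - f u \<partial>\<rho>) = (\<integral>\<^sup>+u. f u - g u \<partial>\<rho>)"
    using a b by (metis ennreal_add_left_cancel infinity_ennreal_def)
  show "(\<integral>\<^sup>+u. f u - g u \<partial>\<rho>) \<le> 1" using a by (metis le_iff_add add.commute)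
qed

lemma
  assumes \<rho>: "prob_space \<rho>" and f[measurable]: "f \<in> borel_measurable \<rho>" and g[measurable]: "g \<in> borel_measurable \<rho>"
    and f1: "(\<integral>\<^sup>+u. f u \<partial>\<rho>) = 1" and g1: "(\<integral>\<^sup>+u. g u \<partial>\<rho>) = 1"
    and h[measurable]: "h \<in> borel_measurable \<rho>"
  shows nn_integral_dens_coupling_fst: "(\<integral>\<^sup>+z. h (fst z) \<partial>dens_coupling \<rho> f g) = (\<integral>\<^sup>+u. f u * h u \<partial>\<rho>)"
    and nn_integral_dens_coupling_snd: "(\<integral>\<^sup>+z. h (snd z) \<partial>dens_coupling \<rho> f g) = (\<integral>\<^sup>+u. g u * h u \<partial>\<rho>)"
proof -
  let ?m = "\<integral>\<^sup>+ w. f w - g w \<partial>\<rho>"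
  note ex = nn_integral_excess_eq[OF f g f1 g1]
  have fin: "?m \<noteq> \<top>" using ex(2) by (auto simp: top_unique)
  \<comment> \<open>The quotient is \<open>1\<close> or, if there is no excess mass, \<open>0\<close>; then the other factor is \<open>0\<close> as well.\<close>
  have quot: "a * (?m / ?m) = a" if "?m = 0 \<Longrightarrow> a = 0" for a
    using that fin by (cases "?m = 0") (auto simp: ennreal_divide_self less_top[symmetric])
  have "(\<integral>\<^sup>+z. h (fst z) \<partial>dens_coupling \<rho> f g) = (\<integral>\<^sup>+u. min (f u) (g u) * h u + (f u - g u) * h u * (?m / ?m) \<partial>\<rho>)"
  proof (subst nn_integral_dens_coupling[OF \<rho> f g], measurable, rule nn_integral_cong)
    fix u
    have "(\<integral>\<^sup>+ v. (f u - g u) * (g v - f v) / ?m * h u \<partial>\<rho>) = (\<integral>\<^sup>+ v. ((f u - g u) * h u / ?m) * (g v - f v) \<partial>\<rho>)"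
      by (intro nn_integral_cong) (simp add: divide_ennreal_def ac_simps)
    also have "\<dots> = (f u - g u) * h u * (?m / ?m)"
      by (subst nn_integral_cmult) (auto simp: ex(1) divide_ennreal_def ac_simps)
    finally show "min (f u) (g u) * h (fst (u, u)) + (\<integral>\<^sup>+ v. (f u - g u) * (g v - f v) / ?m * h (fst (u, v)) \<partial>\<rho>)
      = min (f u) (g u) * h u + (f u - g u) * h u * (?m / ?m)" by simp
  qed
  also have "\<dots> = (\<integral>\<^sup>+u. min (f u) (g u) * h u \<partial>\<rho>) + (\<integral>\<^sup>+u. (f u - g u) * h u \<partial>\<rho>) * (?m / ?m)"
    by (subst nn_integral_add) (auto simp: nn_integral_multc)
  also have "(\<integral>\<^sup>+u. (f u - g u) * h u \<partial>\<rho>) * (?m / ?m) = (\<integral>\<^sup>+u. (f u - g u) * h u \<partial>\<rho>)"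
  proof (rule quot)
    assume "?m = 0"
    then have "AE u in \<rho>. f u - g u = 0" by (subst (asm) nn_integral_0_iff_AE) auto
    then show "(\<integral>\<^sup>+u. (f u - g u) * h u \<partial>\<rho>) = 0"
      by (subst nn_integral_0_iff_AE) auto
  qed
  also have "(\<integral>\<^sup>+u. min (f u) (g u) * h u \<partial>\<rho>) + (\<integral>\<^sup>+u. (f u - g u) * h u \<partial>\<rho>) = (\<integral>\<^sup>+u. f u * h u \<partial>\<rho>)"
    by (subst nn_integral_add[symmetric])
       (auto simp: min_plus_diff_ennreal simp flip: distrib_right)
  finally show "(\<integral>\<^sup>+z. h (fst z) \<partial>dens_coupling \<rho> f g) = (\<integral>\<^sup>+u. f u * h u \<partial>\<rho>)" .

  let ?J = "\<integral>\<^sup>+v. (g v - f v) * h v \<partial>\<rho>"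
  have "(\<integral>\<^sup>+z. h (snd z) \<partial>dens_coupling \<rho> f g) = (\<integral>\<^sup>+u. min (f u) (g u) * h u + (f u - g u) * (?J / ?m) \<partial>\<rho>)"
  proof (subst nn_integral_dens_coupling[OF \<rho> f g], measurable, rule nn_integral_cong)
    fix u
    have "(\<integral>\<^sup>+ v. (f u - g u) * (g v - f v) / ?m * h v \<partial>\<rho>) = (\<integral>\<^sup>+ v. ((f u - g u) / ?m) * ((g v - f v) * h v) \<partial>\<rho>)"
      by (intro nn_integral_cong) (simp add: divide_ennreal_def ac_simps)
    also have "\<dots> = (f u - g u) * (?J / ?m)"
      by (subst nn_integral_cmult) (auto simp: divide_ennreal_def ac_simps)
    finally show "min (f u) (g u) * h (snd (u, u)) + (\<integral>\<^sup>+ v. (f u - g u) * (g v - f v) / ?m * h (snd (u, v)) \<partial>\<rho>)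
      = min (f u) (g u) * h u + (f u - g u) * (?J / ?m)" by simp
  qed
  also have "\<dots> = (\<integral>\<^sup>+u. min (f u) (g u) * h u \<partial>\<rho>) + ?m * (?J / ?m)"
    by (subst nn_integral_add) (auto simp: nn_integral_multc)
  also have "?m * (?J / ?m) = ?J * (?m / ?m)" by (simp add: divide_ennreal_def ac_simps)
  also have "\<dots> = ?J"
  proof (rule quot)
    assume "?m = 0"
    then have "AE u in \<rho>. g u - f u = 0" unfolding ex(1)[symmetric] by (subst (asm) nn_integral_0_iff_AE) auto
    then show "?J = 0" by (subst nn_integral_0_iff_AE) auto
  qed
  also have "(\<integral>\<^sup>+u. min (f u) (g u) * h u \<partial>\<rho>) + ?J = (\<integral>\<^sup>+u. g u * h u \<partial>\<rho>)"
    by (subst nn_integral_add[symmetric])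
       (auto simp: min_plus_diff_ennreal min.commute[of "f _"] simp flip: distrib_right)
  finally show "(\<integral>\<^sup>+z. h (snd z) \<partial>dens_coupling \<rho> f g) = (\<integral>\<^sup>+u. g u * h u \<partial>\<rho>)" .
qed

lemma dens_coupling_Cpl:
  assumes \<rho>: "prob_space \<rho>" and f[measurable]: "f \<in> borel_measurable \<rho>" and g[measurable]: "g \<in> borel_measurable \<rho>"
    and f1: "(\<integral>\<^sup>+u. f u \<partial>\<rho>) = 1" and g1: "(\<integral>\<^sup>+u. g u \<partial>\<rho>) = 1"
  shows "dens_coupling \<rho> f g \<in> Cpl (density \<rho> f) (density \<rho> g)"
proof -
  let ?C = "dens_coupling \<rho> f g"
  have s[simp, measurable_cong]: "sets ?C = sets (\<rho> \<Otimes>\<^sub>M \<rho>)" by (simp add: dens_coupling_def)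
  have sp: "space ?C = space (\<rho> \<Otimes>\<^sub>M \<rho>)" by (rule sets_eq_imp_space_eq) simp
  have "emeasure ?C (space ?C) = (\<integral>\<^sup>+z. 1 \<partial>?C)" by simp
  also have "\<dots> = 1" using nn_integral_dens_coupling_fst[OF assms, of "\<lambda>_. 1"] f1 by simp
  finally have "prob_space ?C" by (rule prob_spaceI)
  moreover have "distr ?C (density \<rho> f) fst = density \<rho> f"
  proof (rule measure_eqI)
    fix A assume "A \<in> sets (distr ?C (density \<rho> f) fst)"
    then have A[measurable]: "A \<in> sets \<rho>" by simp
    have "emeasure (distr ?C (density \<rho> f) fst) A = (\<integral>\<^sup>+z. indicator A (fst z) \<partial>?C)"
      by (subst nn_integral_distr[symmetric, where M'="density \<rho> f" and f="indicator A"]) auto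
    then show "emeasure (distr ?C (density \<rho> f) fst) A = emeasure (density \<rho> f) A"
      by (simp add: nn_integral_dens_coupling_fst[OF assms] emeasure_density)
  qed simp
  moreover have "distr ?C (density \<rho> g) snd = density \<rho> g"
  proof (rule measure_eqI)
    fix A assume "A \<in> sets (distr ?C (density \<rho> g) snd)"
    then have A[measurable]: "A \<in> sets \<rho>" by simp
    have "emeasure (distr ?C (density \<rho> g) snd) A = (\<integral>\<^sup>+z. indicator A (snd z) \<partial>?C)"
      by (subst nn_integral_distr[symmetric, where M'="density \<rho> g" and f="indicator A"]) auto
    then show "emeasure (distr ?C (density \<rho> g) snd) A = emeasure (density \<rho> g) A"
      by (simp add: nn_integral_dens_coupling_snd[OF assms] emeasure_density)
  qed simp
  ultimately show ?thesis
    by (simp add: Cpl_def space_prob_algebra cong: sets_pair_measure_cong)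
qed

text \<open>
  Off the diagonal only the two excesses contribute.
\<close>

lemma dens_coupling_off_diagonal:
  assumes \<rho>: "prob_space \<rho>" and f[measurable]: "f \<in> borel_measurable \<rho>" and g[measurable]: "g \<in> borel_measurable \<rho>"
    and f1: "(\<integral>\<^sup>+u. f u \<partial>\<rho>) = 1" and g1: "(\<integral>\<^sup>+u. g u \<partial>\<rho>) = 1"
    and h[measurable]: "h \<in> borel_measurable \<rho>"
    and D[measurable]: "Measurable.pred (\<rho> \<Otimes>\<^sub>M \<rho>) (\<lambda>z. fst z = snd z)"
  shows "(\<integral>\<^sup>+z. (h (fst z) + h (snd z)) * indicator {z. fst z \<noteq> snd z} z \<partial>dens_coupling \<rho> f g)
     \<le> (\<integral>\<^sup>+u. (f u - g u) * h u \<partial>\<rho>) + (\<integral>\<^sup>+u. (g u - f u) * h u \<partial>\<rho>)"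
proof -
  let ?m = "\<integral>\<^sup>+ w. f w - g w \<partial>\<rho>"
  interpret prob_space \<rho> by fact
  note ex = nn_integral_excess_eq[OF f g f1 g1]
  have mm: "?m / ?m \<le> 1"
  proof (cases "?m = 0")
    case False
    moreover have "?m < \<top>" using ex(2) by (rule order.strict_trans1) simp
    ultimately show ?thesis by simp
  qed simp
  have "(\<integral>\<^sup>+z. (h (fst z) + h (snd z)) * indicator {z. fst z \<noteq> snd z} z \<partial>dens_coupling \<rho> f g)
     \<le> (\<integral>\<^sup>+u. \<integral>\<^sup>+v. (f u - g u) * (g v - f v) / ?m * (h u + h v) \<partial>\<rho> \<partial>\<rho>)"
    by (subst nn_integral_dens_coupling[OF \<rho> f g], measurable, intro nn_integral_mono)
       (auto intro!: nn_integral_mono mult_left_mono simp: indicator_def)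
  also have "\<dots> = (\<integral>\<^sup>+u. (f u - g u) * h u * (?m / ?m) + (f u - g u) * ((\<integral>\<^sup>+v. (g v - f v) * h v \<partial>\<rho>) / ?m) \<partial>\<rho>)"
  proof (rule nn_integral_cong)
    fix u
    have "(\<integral>\<^sup>+v. (f u - g u) * (g v - f v) / ?m * (h u + h v) \<partial>\<rho>)
      = (\<integral>\<^sup>+v. ((f u - g u) * h u / ?m) * (g v - f v) + ((f u - g u) / ?m) * ((g v - f v) * h v) \<partial>\<rho>)"
      by (intro nn_integral_cong) (simp add: divide_ennreal_def distrib_left distrib_right ac_simps)
    also have "\<dots> = ((f u - g u) * h u / ?m) * ?m + ((f u - g u) / ?m) * (\<integral>\<^sup>+v. (g v - f v) * h v \<partial>\<rho>)"
      by (subst nn_integral_add) (auto simp: nn_integral_cmult ex(1))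
    finally show "(\<integral>\<^sup>+v. (f u - g u) * (g v - f v) / ?m * (h u + h v) \<partial>\<rho>)
      = (f u - g u) * h u * (?m / ?m) + (f u - g u) * ((\<integral>\<^sup>+v. (g v - f v) * h v \<partial>\<rho>) / ?m)"
      by (simp add: divide_ennreal_def ac_simps)
  qed
  also have "\<dots> = (\<integral>\<^sup>+u. (f u - g u) * h u \<partial>\<rho>) * (?m / ?m) + ?m * ((\<integral>\<^sup>+v. (g v - f v) * h v \<partial>\<rho>) / ?m)"
    by (subst nn_integral_add) (auto simp: nn_integral_multc)
  also have "\<dots> = (\<integral>\<^sup>+u. (f u - g u) * h u \<partial>\<rho>) * (?m / ?m) + (\<integral>\<^sup>+v. (g v - f v) * h v \<partial>\<rho>) * (?m / ?m)"
    by (simp add: divide_ennreal_def ac_simps)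
  also have "\<dots> \<le> (\<integral>\<^sup>+u. (f u - g u) * h u \<partial>\<rho>) + (\<integral>\<^sup>+u. (g u - f u) * h u \<partial>\<rho>)"
    by (intro add_mono order_trans[OF mult_left_mono[OF mm]]) auto
  finally show ?thesis .
qed

section \<open>Measurable maximal couplings of two kernels\<close>

lemma borel_countable_Int_stable_generator:
  obtains G :: "'b::second_countable_topology set set"
  where "countable G" "Int_stable G" "UNIV \<in> G" "sets borel = sigma_sets UNIV G"
proof -
  obtain B :: "'b set set" where B: "countable B" "topological_basis B"
    using ex_countable_basis by auto
  define G where "G = Inter ` {F. finite F \<and> F \<subseteq> B}"
  have "countable G"
    unfolding G_def using B(1) by (intro countable_image countable_Collect_finite_subset)
  moreover have "Int_stable G"
  proof (rule Int_stableI)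
    fix a b assume "a \<in> G" "b \<in> G"
    then obtain E F where "finite E" "E \<subseteq> B" "a = \<Inter>E" "finite F" "F \<subseteq> B" "b = \<Inter>F"
      unfolding G_def by auto
    then show "a \<inter> b \<in> G" unfolding G_def by (auto intro!: image_eqI[of _ _ "E \<union> F"])
  qed
  moreover have "UNIV \<in> G" unfolding G_def by (auto intro!: image_eqI[of _ _ "{}"])
  moreover have "sets borel = sigma_sets UNIV G"
  proof
    have "B \<subseteq> G" unfolding G_def by (auto intro!: image_eqI[of _ _ "{_}"])
    then have "sigma_sets UNIV B \<subseteq> sigma_sets UNIV G" by (rule sigma_sets_mono')
    then show "sets borel \<subseteq> sigma_sets UNIV G" by (simp add: borel_eq_countable_basis[OF B])
    have "open X" if "X \<in> G" for X
      using that B(2) unfolding G_def by (auto intro!: open_Inter dest: topological_basis_open)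
    then show "sigma_sets UNIV G \<subseteq> sets borel"
      by (intro sets.sigma_sets_subset[where M=borel, simplified]) auto
  qed
  ultimately show ?thesis by (rule that)
qed

text \<open>
  A density between the joint laws of two kernels is, for almost every \<open>x\<close>, a density between the
  kernels at \<open>x\<close>. For a fixed set \<open>B\<close> the values at \<open>B\<close> agree almost everywhere; a countable generator
  makes the exceptional null set independent of \<open>B\<close>.
\<close>

lemma kernel_eq_density_AE:
  fixes K \<rho> :: "'a \<Rightarrow> 'b::second_countable_topology measure"
  assumes \<eta>: "finite_measure \<eta>"
    and K: "K \<in> \<eta> \<rightarrow>\<^sub>M prob_algebra borel" and \<rho>: "\<rho> \<in> \<eta> \<rightarrow>\<^sub>M prob_algebra borel"
    and f[measurable]: "f \<in> borel_measurable (\<eta> \<Otimes>\<^sub>M borel)"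
    and eq: "kernel_prod \<eta> borel K = density (kernel_prod \<eta> borel \<rho>) f"
  shows "AE x in \<eta>. K x = density (\<rho> x) (\<lambda>u. f (x, u))"
proof (cases "space \<eta> = {}")
  case False
  interpret finite_measure \<eta> by fact
  note K' = measurable_prob_algebraD[OF K] and \<rho>' = measurable_prob_algebraD[OF \<rho>]
  obtain G :: "'b set set" where G: "countable G" "Int_stable G" "UNIV \<in> G" "sets borel = sigma_sets UNIV G"
    by (rule borel_countable_Int_stable_generator)
  have GB: "B \<in> sets borel" if "B \<in> G" for B using that G(4) by (simp add: sigma_sets.Basic)
  have [measurable]: "(\<lambda>x. \<integral>\<^sup>+u. f (x, u) * indicator B u \<partial>\<rho> x) \<in> borel_measurable \<eta>" if [measurable]: "B \<in> sets borel" for B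
    by (rule nn_integral_measurable_subprob_algebra2[OF _ \<rho>']) measurable
  have sR: "sets (kernel_prod \<eta> borel \<rho>) = sets (\<eta> \<Otimes>\<^sub>M borel)" by (rule sets_kernel_prod[OF \<rho> False])
  have "AE x in \<eta>. emeasure (K x) B = (\<integral>\<^sup>+u. f (x, u) * indicator B u \<partial>\<rho> x)" if "B \<in> G" for B
  proof (rule density_unique_finite_measure)
    note [measurable] = GB[OF that]
    show "(\<lambda>x. emeasure (K x) B) \<in> borel_measurable \<eta>"
      using measurable_emeasure_kernel[OF K'] by simp
    fix A assume A[measurable]: "A \<in> sets \<eta>"
    have "(\<integral>\<^sup>+x. emeasure (K x) B * indicator A x \<partial>\<eta>) = emeasure (kernel_prod \<eta> borel K) (A \<times> B)"
      by (rule emeasure_kernel_prod_Times[OF K False, symmetric]) auto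
    also have "\<dots> = (\<integral>\<^sup>+z. f z * indicator (A \<times> B) z \<partial>kernel_prod \<eta> borel \<rho>)"
      unfolding eq by (subst emeasure_density) (auto simp: sR cong: measurable_cong_sets)
    also have "\<dots> = (\<integral>\<^sup>+x. \<integral>\<^sup>+u. f (x, u) * indicator (A \<times> B) (x, u) \<partial>\<rho> x \<partial>\<eta>)"
      by (rule nn_integral_kernel_prod[OF \<rho>]) measurable
    also have "\<dots> = (\<integral>\<^sup>+x. (\<integral>\<^sup>+u. f (x, u) * indicator B u \<partial>\<rho> x) * indicator A x \<partial>\<eta>)"
    proof (rule nn_integral_cong)
      fix x assume x: "x \<in> space \<eta>"
      show "(\<integral>\<^sup>+u. f (x, u) * indicator (A \<times> B) (x, u) \<partial>\<rho> x) = (\<integral>\<^sup>+u. f (x, u) * indicator B u \<partial>\<rho> x) * indicator A x"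
        by (simp add: indicator_def)
    qed
    finally show "(\<integral>\<^sup>+x. emeasure (K x) B * indicator A x \<partial>\<eta>) =
      (\<integral>\<^sup>+x. (\<integral>\<^sup>+u. f (x, u) * indicator B u \<partial>\<rho> x) * indicator A x \<partial>\<eta>)" .
  qed (use GB[OF that] in auto)
  then have "AE x in \<eta>. \<forall>B\<in>G. emeasure (K x) B = (\<integral>\<^sup>+u. f (x, u) * indicator B u \<partial>\<rho> x)"
    using G(1) by (simp add: AE_ball_countable)
  then show ?thesis
  proof (rule AE_mp, intro AE_I2 impI)
    fix x assume x: "x \<in> space \<eta>" and *: "\<forall>B\<in>G. emeasure (K x) B = (\<integral>\<^sup>+u. f (x, u) * indicator B u \<partial>\<rho> x)"
    have Kx: "sets (K x) = sets borel" "prob_space (K x)" and \<rho>x: "sets (\<rho> x) = sets borel" "space (\<rho> x) = UNIV"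
      using measurable_space[OF K x] measurable_space[OF \<rho> x]
      by (auto simp: space_prob_algebra dest: sets_eq_imp_space_eq)
    have fx[measurable]: "(\<lambda>u. f (x, u)) \<in> borel_measurable borel"
      using x by measurable
    have em: "emeasure (K x) B = emeasure (density (\<rho> x) (\<lambda>u. f (x, u))) B" if "B \<in> G" for B
      using *[rule_format, OF that] GB[OF that] fx \<rho>x
      by (subst emeasure_density) (auto cong: measurable_cong_sets)
    interpret Kx: prob_space "K x" by (rule Kx)
    show "K x = density (\<rho> x) (\<lambda>u. f (x, u))"
    proof (rule measure_eqI_generator_eq[OF G(2), of UNIV _ _ "\<lambda>_. UNIV"])
      show "emeasure (K x) UNIV \<noteq> \<infinity>" for i :: nat using Kx.emeasure_finite by simp
    qed (use em Kx \<rho>x G in auto)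
  qed
next
  case True
  then show ?thesis by (auto intro: AE_I2)
qed

text \<open>
  The average \<open>(K x + L x) / 2\<close>, written as the choice between \<open>K x\<close> and \<open>L x\<close> by a fair coin. It is a
  probability kernel that dominates both.
\<close>

definition mix_kernel :: "('a \<Rightarrow> 'b measure) \<Rightarrow> ('a \<Rightarrow> 'b measure) \<Rightarrow> 'a \<Rightarrow> 'b measure" where
  "mix_kernel K L x = measure_pmf (pmf_of_set (UNIV :: bool set)) \<bind> (\<lambda>b. if b then K x else L x)"

lemma mix_kernel_measurable:
  assumes [measurable]: "K \<in> N \<rightarrow>\<^sub>M prob_algebra S" "L \<in> N \<rightarrow>\<^sub>M prob_algebra S"
  shows "mix_kernel K L \<in> N \<rightarrow>\<^sub>M prob_algebra S"
proof -
  have c: "(\<lambda>x. measure_pmf (pmf_of_set (UNIV :: bool set))) \<in> N \<rightarrow>\<^sub>M prob_algebra (count_space UNIV)"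
    by (intro measurable_const) (auto simp: space_prob_algebra measure_pmf.prob_space_axioms)
  have "(\<lambda>(x, b). if b then K x else L x) \<in> N \<Otimes>\<^sub>M count_space UNIV \<rightarrow>\<^sub>M prob_algebra S"
    unfolding split_beta' by measurable
  then show ?thesis
    unfolding mix_kernel_def[abs_def] by (intro measurable_bind_prob_space2[OF c])
qed

lemma nn_integral_mix_kernel:
  assumes K: "K \<in> N \<rightarrow>\<^sub>M prob_algebra S" and L: "L \<in> N \<rightarrow>\<^sub>M prob_algebra S" and x: "x \<in> space N"
    and h: "h \<in> borel_measurable S"
  shows "(\<integral>\<^sup>+u. h u \<partial>mix_kernel K L x) = ((\<integral>\<^sup>+u. h u \<partial>K x) + (\<integral>\<^sup>+u. h u \<partial>L x)) / 2"
proof -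
  have "(\<lambda>b. if b then K x else L x) \<in> measure_pmf (pmf_of_set (UNIV :: bool set)) \<rightarrow>\<^sub>M subprob_algebra S"
    using measurable_space[OF measurable_prob_algebraD[OF K] x] measurable_space[OF measurable_prob_algebraD[OF L] x]
    by (auto simp: measurable_def)
  from nn_integral_bind[OF h this] show ?thesis
    unfolding mix_kernel_def by (simp add: nn_integral_pmf_of_set UNIV_bool add.commute)
qed

text \<open>
  The Radon-Nikodym theorem for kernels: applied to the joint laws, it yields densities that are
  jointly measurable in \<open>x\<close> and \<open>u\<close>.
\<close>

lemma kernel_density:
  fixes K \<rho> :: "'a \<Rightarrow> 'b::second_countable_topology measure"
  assumes \<eta>: "finite_measure \<eta>"
    and K: "K \<in> \<eta> \<rightarrow>\<^sub>M prob_algebra borel" and \<rho>: "\<rho> \<in> \<eta> \<rightarrow>\<^sub>M prob_algebra borel"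
    and dom: "\<And>x h. x \<in> space \<eta> \<Longrightarrow> h \<in> borel_measurable borel \<Longrightarrow> (\<integral>\<^sup>+u. h u \<partial>K x) \<le> 2 * (\<integral>\<^sup>+u. h u \<partial>\<rho> x)"
  obtains f where "f \<in> borel_measurable (\<eta> \<Otimes>\<^sub>M borel)" "AE x in \<eta>. K x = density (\<rho> x) (\<lambda>u. f (x, u))"
proof (cases "space \<eta> = {}")
  case False
  interpret finite_measure \<eta> by fact
  let ?P = "kernel_prod \<eta> borel K" and ?R = "kernel_prod \<eta> borel \<rho>"
  have s: "sets ?R = sets (\<eta> \<Otimes>\<^sub>M borel)" "sets ?P = sets (\<eta> \<Otimes>\<^sub>M borel)"
    by (rule sets_kernel_prod[OF \<rho> False] sets_kernel_prod[OF K False])+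
  have "emeasure ?R (space ?R) = (\<integral>\<^sup>+x. \<integral>\<^sup>+u. 1 \<partial>\<rho> x \<partial>\<eta>)"
    using nn_integral_kernel_prod[OF \<rho>, of "\<lambda>_. 1"] by simp
  also have "\<dots> = (\<integral>\<^sup>+x. 1 \<partial>\<eta>)"
    using measurable_space[OF \<rho>]
    by (intro nn_integral_cong) (auto simp: space_prob_algebra prob_space.emeasure_space_1)
  also have "\<dots> < \<infinity>" by (simp add: less_top[symmetric])
  finally interpret R: finite_measure ?R by (intro finite_measureI) auto
  have ac: "absolutely_continuous ?R ?P"
    unfolding absolutely_continuous_def
  proof
    fix Z assume Z: "Z \<in> null_sets ?R"
    then have [measurable]: "Z \<in> sets (\<eta> \<Otimes>\<^sub>M borel)" using s by auto
    have ZR: "(\<integral>\<^sup>+x. \<integral>\<^sup>+u. indicator Z (x, u) \<partial>\<rho> x \<partial>\<eta>) = 0"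
      using Z nn_integral_indicator[OF null_setsD2[OF Z]]
      by (subst nn_integral_kernel_prod[OF \<rho>, symmetric]) auto
    have "(\<integral>\<^sup>+x. \<integral>\<^sup>+u. indicator Z (x, u) \<partial>K x \<partial>\<eta>) \<le> (\<integral>\<^sup>+x. 2 * \<integral>\<^sup>+u. indicator Z (x, u) \<partial>\<rho> x \<partial>\<eta>)"
      by (intro nn_integral_mono dom) measurable
    also have "\<dots> = 2 * (\<integral>\<^sup>+x. \<integral>\<^sup>+u. indicator Z (x, u) \<partial>\<rho> x \<partial>\<eta>)"
      by (intro nn_integral_cmult nn_integral_measurable_subprob_algebra2[OF _ measurable_prob_algebraD[OF \<rho>]]) measurable
    finally have "(\<integral>\<^sup>+x. \<integral>\<^sup>+u. indicator Z (x, u) \<partial>K x \<partial>\<eta>) = 0" using ZR by simp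
    then have "emeasure ?P Z = 0"
      by (subst (asm) nn_integral_kernel_prod[OF K, symmetric]) (auto simp: s)
    then show "Z \<in> null_sets ?P" using s by auto
  qed
  show ?thesis
  proof (rule that)
    show f: "RN_deriv ?R ?P \<in> borel_measurable (\<eta> \<Otimes>\<^sub>M borel)"
      using borel_measurable_RN_deriv[of ?R ?P] s by (simp cong: measurable_cong_sets)
    show "AE x in \<eta>. K x = density (\<rho> x) (\<lambda>u. RN_deriv ?R ?P (x, u))"
      using R.density_RN_deriv[OF ac] s by (intro kernel_eq_density_AE[OF \<eta> K \<rho> f]) simp
  qed
next
  case True
  then show ?thesis by (intro that[of "\<lambda>_. 0"]) (auto intro: AE_I2)
qed

lemma dens_coupling_measurable:
  assumes \<rho>: "\<rho> \<in> N \<rightarrow>\<^sub>M prob_algebra S"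
    and f[measurable]: "f \<in> borel_measurable (N \<Otimes>\<^sub>M S)" and g[measurable]: "g \<in> borel_measurable (N \<Otimes>\<^sub>M S)"
    and f1: "\<And>x. x \<in> space N \<Longrightarrow> (\<integral>\<^sup>+u. f (x, u) \<partial>\<rho> x) = 1"
    and g1: "\<And>x. x \<in> space N \<Longrightarrow> (\<integral>\<^sup>+u. g (x, u) \<partial>\<rho> x) = 1"
  shows "(\<lambda>x. dens_coupling (\<rho> x) (\<lambda>u. f (x, u)) (\<lambda>u. g (x, u))) \<in> N \<rightarrow>\<^sub>M prob_algebra (S \<Otimes>\<^sub>M S)"
proof -
  note \<rho>' = measurable_prob_algebraD[OF \<rho>]
  let ?C = "\<lambda>x. dens_coupling (\<rho> x) (\<lambda>u. f (x, u)) (\<lambda>u. g (x, u))"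
  have \<rho>x: "prob_space (\<rho> x)" "sets (\<rho> x) = sets S" if "x \<in> space N" for x
    using measurable_space[OF \<rho> that] by (auto simp: space_prob_algebra)
  have m: "(\<lambda>u. f (x, u)) \<in> borel_measurable (\<rho> x)" "(\<lambda>u. g (x, u)) \<in> borel_measurable (\<rho> x)" if "x \<in> space N" for x
    unfolding measurable_cong_sets[OF \<rho>x(2)[OF that] refl] using that by measurable
  have C: "prob_space (?C x)" "sets (?C x) = sets (S \<Otimes>\<^sub>M S)" if x: "x \<in> space N" for x
  proof -
    have "?C x \<in> Cpl (density (\<rho> x) (\<lambda>u. f (x, u))) (density (\<rho> x) (\<lambda>u. g (x, u)))"
      by (rule dens_coupling_Cpl[OF \<rho>x(1)[OF x] m[OF x] f1[OF x] g1[OF x]])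
    then show "prob_space (?C x)" by (simp add: Cpl_def space_prob_algebra)
    show "sets (?C x) = sets (S \<Otimes>\<^sub>M S)"
      unfolding dens_coupling_def by (simp add: \<rho>x(2)[OF x] cong: sets_pair_measure_cong)
  qed
  have [measurable]: "(\<lambda>x. \<integral>\<^sup>+w. f (x, w) - g (x, w) \<partial>\<rho> x) \<in> borel_measurable N"
    by (rule nn_integral_measurable_subprob_algebra2[OF _ \<rho>']) measurable
  show ?thesis
  proof (intro measurable_prob_algebraI measurable_subprob_algebra)
    fix A assume A[measurable]: "A \<in> sets (S \<Otimes>\<^sub>M S)"
    have r2: "(\<lambda>(x, u). \<rho> x) \<in> N \<Otimes>\<^sub>M S \<rightarrow>\<^sub>M subprob_algebra S"
      unfolding split_beta' by (rule measurable_compose[OF measurable_fst \<rho>'])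
    have inner: "(\<lambda>p. \<integral>\<^sup>+v. (f (fst p, snd p) - g (fst p, snd p)) * (g (fst p, v) - f (fst p, v)) /
        (\<integral>\<^sup>+w. f (fst p, w) - g (fst p, w) \<partial>\<rho> (fst p)) * indicator A (snd p, v) \<partial>\<rho> (fst p)) \<in> borel_measurable (N \<Otimes>\<^sub>M S)"
      by (rule nn_integral_measurable_subprob_algebra2[where N=S]) (use r2 in \<open>auto simp: split_beta'\<close>)
    have "(\<lambda>x. \<integral>\<^sup>+u. (min (f (x, u)) (g (x, u)) * indicator A (u, u) +
       (\<integral>\<^sup>+v. (f (x, u) - g (x, u)) * (g (x, v) - f (x, v)) / (\<integral>\<^sup>+w. f (x, w) - g (x, w) \<partial>\<rho> x) * indicator A (u, v) \<partial>\<rho> x)) \<partial>\<rho> x)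
       \<in> borel_measurable N"
    proof (rule nn_integral_measurable_subprob_algebra2[OF _ \<rho>'])
      show "(\<lambda>(x, u). min (f (x, u)) (g (x, u)) * indicator A (u, u) +
       (\<integral>\<^sup>+v. (f (x, u) - g (x, u)) * (g (x, v) - f (x, v)) / (\<integral>\<^sup>+w. f (x, w) - g (x, w) \<partial>\<rho> x) * indicator A (u, v) \<partial>\<rho> x))
       \<in> borel_measurable (N \<Otimes>\<^sub>M S)"
        unfolding split_beta' by (intro borel_measurable_add inner) measurable
    qed
    then show "(\<lambda>x. emeasure (?C x) A) \<in> borel_measurable N"
    proof (rule measurable_cong[THEN iffD1, rotated])
      fix x assume x: "x \<in> space N"
      have "emeasure (?C x) A = (\<integral>\<^sup>+z. indicator A z \<partial>?C x)" using A C(2)[OF x] by simp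
      also have "\<dots> = (\<integral>\<^sup>+u. (min (f (x, u)) (g (x, u)) * indicator A (u, u) +
       (\<integral>\<^sup>+v. (f (x, u) - g (x, u)) * (g (x, v) - f (x, v)) / (\<integral>\<^sup>+w. f (x, w) - g (x, w) \<partial>\<rho> x) * indicator A (u, v) \<partial>\<rho> x)) \<partial>\<rho> x)"
        using A \<rho>x(2)[OF x] by (intro nn_integral_dens_coupling \<rho>x(1)[OF x] m[OF x]) (simp cong: sets_pair_measure_cong)
      finally show "(\<integral>\<^sup>+u. (min (f (x, u)) (g (x, u)) * indicator A (u, u) +
       (\<integral>\<^sup>+v. (f (x, u) - g (x, u)) * (g (x, v) - f (x, v)) / (\<integral>\<^sup>+w. f (x, w) - g (x, w) \<partial>\<rho> x) * indicator A (u, v) \<partial>\<rho> x)) \<partial>\<rho> x)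
         = emeasure (?C x) A" by simp
    qed
  qed (use C in \<open>auto simp: prob_space_imp_subprob_space\<close>)
qed

lemma Cpl_pair_measure:
  assumes "prob_space M" "prob_space N"
  shows "M \<Otimes>\<^sub>M N \<in> Cpl M N"
proof -
  interpret M: prob_space M by fact
  interpret N: prob_space N by fact
  interpret pair_prob_space M N ..
  have "distr (M \<Otimes>\<^sub>M N) M fst = M"
    by (rule measure_eqI)
       (auto simp: N.distr_pair_fst emeasure_distr)
  moreover have "distr (M \<Otimes>\<^sub>M N) N snd = N"
  proof (rule measure_eqI)
    fix A assume "A \<in> sets (distr (M \<Otimes>\<^sub>M N) N snd)"
    then have A: "A \<in> sets N" by simp
    then have "snd -` A \<inter> space (M \<Otimes>\<^sub>M N) = space M \<times> A"
      using sets.sets_into_space[OF A] by (auto simp: space_pair_measure)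
    then show "emeasure (distr (M \<Otimes>\<^sub>M N) N snd) A = emeasure N A"
      using A by (simp add: emeasure_distr N.emeasure_pair_measure_Times M.emeasure_space_1)
  qed simp
  ultimately show ?thesis
    by (simp add: Cpl_def space_prob_algebra prob_space_axioms)
qed

text \<open>
  The pointwise form of the inequality in the next lemma, with \<open>a\<close> and \<open>b\<close> for the densities of the
  two kernels.
\<close>

lemma excess_split_ennreal:
  fixes a b :: ennreal
  shows "(a - b) + (b - a) + b * of_bool (b \<le> a) + a * of_bool (\<not> b \<le> a)
    = a * of_bool (b \<le> a) + b * of_bool (\<not> b \<le> a)"
proof (cases "b \<le> a")
  case True
  show ?thesis
  proof (cases "b = \<top>")
    case False
    then have "b - a = 0" using True by (subst diff_eq_0_iff_ennreal) (auto simp: less_top)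
    then show ?thesis using True by (simp add: diff_add_cancel_ennreal)
  qed (use True in \<open>simp add: top_unique\<close>)
next
  case False
  then have "a - b = 0" by (subst diff_eq_0_iff_ennreal) (auto simp: not_le intro: order.strict_trans2[OF _ top_greatest])
  then show ?thesis using False by (simp add: diff_add_cancel_ennreal)
qed

text \<open>
  A measurable choice of maximal couplings of \<open>K x\<close> and \<open>L x\<close>. In the last conclusion \<open>Y\<close> plays the
  role of a Hahn set on which \<open>K\<close> dominates \<open>L\<close>: it bounds the off-diagonal part of \<open>C\<close> by
  \<open>\<integral> h d|\<eta> \<otimes> K - \<eta> \<otimes> L|\<close>, in a form without subtraction. Maximality is only needed \<open>\<eta>\<close>-almost everywhere,
  whereas the marginals are right for every \<open>x\<close>.
\<close>

lemma maximal_kernel_coupling: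
  fixes K L :: "'a \<Rightarrow> 'b::{second_countable_topology, t2_space} measure"
  assumes \<eta>: "finite_measure \<eta>"
    and K: "K \<in> \<eta> \<rightarrow>\<^sub>M prob_algebra borel" and L: "L \<in> \<eta> \<rightarrow>\<^sub>M prob_algebra borel"
  obtains C Y where "C \<in> \<eta> \<rightarrow>\<^sub>M prob_algebra (borel \<Otimes>\<^sub>M borel)"
    "\<And>x. x \<in> space \<eta> \<Longrightarrow> C x \<in> Cpl (K x) (L x)"
    "Y \<in> sets (\<eta> \<Otimes>\<^sub>M borel)"
    "\<And>h. h \<in> borel_measurable (\<eta> \<Otimes>\<^sub>M borel) \<Longrightarrow>
      (\<integral>\<^sup>+x. \<integral>\<^sup>+z. (h (x, fst z) + h (x, snd z)) * indicator {z. fst z \<noteq> snd z} z \<partial>C x \<partial>\<eta>)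
        + (\<integral>\<^sup>+x. \<integral>\<^sup>+u. h (x, u) * indicator Y (x, u) \<partial>L x \<partial>\<eta>)
        + (\<integral>\<^sup>+x. \<integral>\<^sup>+u. h (x, u) * indicator (- Y) (x, u) \<partial>K x \<partial>\<eta>)
      \<le> (\<integral>\<^sup>+x. \<integral>\<^sup>+u. h (x, u) * indicator Y (x, u) \<partial>K x \<partial>\<eta>)
        + (\<integral>\<^sup>+x. \<integral>\<^sup>+u. h (x, u) * indicator (- Y) (x, u) \<partial>L x \<partial>\<eta>)"
proof -
  interpret finite_measure \<eta> by fact
  define \<rho> where "\<rho> = mix_kernel K L"
  have \<rho>: "\<rho> \<in> \<eta> \<rightarrow>\<^sub>M prob_algebra borel"
    unfolding \<rho>_def by (rule mix_kernel_measurable[OF K L])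
  note K' = measurable_prob_algebraD[OF K] and L' = measurable_prob_algebraD[OF L] and \<rho>' = measurable_prob_algebraD[OF \<rho>]
  have half: "(a :: ennreal) \<le> 2 * ((a + b) / 2)" "(b :: ennreal) \<le> 2 * ((a + b) / 2)" for a b
  proof -
    have "2 * ((a + b) / 2) = a + b"
      by (subst mult.commute, rule ennreal_divide_times[THEN trans]) (simp add: mult_divide_eq_ennreal)
    then show "a \<le> 2 * ((a + b) / 2)" "b \<le> 2 * ((a + b) / 2)" by simp_all
  qed
  obtain f0 where f0[measurable]: "f0 \<in> borel_measurable (\<eta> \<Otimes>\<^sub>M borel)"
    and f0_eq: "AE x in \<eta>. K x = density (\<rho> x) (\<lambda>u. f0 (x, u))"
    by (rule kernel_density[OF \<eta> K \<rho>]) (auto simp: \<rho>_def nn_integral_mix_kernel[OF K L] half)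
  obtain g0 where g0[measurable]: "g0 \<in> borel_measurable (\<eta> \<Otimes>\<^sub>M borel)"
    and g0_eq: "AE x in \<eta>. L x = density (\<rho> x) (\<lambda>u. g0 (x, u))"
    by (rule kernel_density[OF \<eta> L \<rho>]) (auto simp: \<rho>_def nn_integral_mix_kernel[OF K L] half)
  from f0_eq g0_eq have "AE x in \<eta>. K x = density (\<rho> x) (\<lambda>u. f0 (x, u)) \<and> L x = density (\<rho> x) (\<lambda>u. g0 (x, u))"
    by eventually_elim simp
  then obtain Z where Z: "Z \<in> null_sets \<eta>"
    and "{x \<in> space \<eta>. \<not> (K x = density (\<rho> x) (\<lambda>u. f0 (x, u)) \<and> L x = density (\<rho> x) (\<lambda>u. g0 (x, u)))} \<subseteq> Z"
    by (auto simp: eventually_ae_filter)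
  then have KL0: "K x = density (\<rho> x) (\<lambda>u. f0 (x, u))" "L x = density (\<rho> x) (\<lambda>u. g0 (x, u))"
    if "x \<in> space \<eta>" "x \<notin> Z" for x using that by auto
  have Zm[measurable]: "Z \<in> sets \<eta>" using Z by auto
  \<comment> \<open>On the null set \<open>Z\<close> the densities are reset to \<open>1\<close>, which keeps \<open>dens_coupling\<close> a probability measure there.\<close>
  define f where "f p = (if fst p \<in> Z then 1 else f0 p)" for p
  define g where "g p = (if fst p \<in> Z then 1 else g0 p)" for p
  have f[measurable]: "f \<in> borel_measurable (\<eta> \<Otimes>\<^sub>M borel)" and g[measurable]: "g \<in> borel_measurable (\<eta> \<Otimes>\<^sub>M borel)"
    unfolding f_def[abs_def] g_def[abs_def] by measurable
  have KL: "K x = density (\<rho> x) (\<lambda>u. f (x, u))" "L x = density (\<rho> x) (\<lambda>u. g (x, u))"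
    if "x \<in> space \<eta>" "x \<notin> Z" for x using KL0[OF that] that by (simp_all add: f_def g_def)
  have \<rho>x: "prob_space (\<rho> x)" "sets (\<rho> x) = sets borel" if "x \<in> space \<eta>" for x
    using measurable_space[OF \<rho> that] by (auto simp: space_prob_algebra)
  have Kx: "prob_space (K x)" "sets (K x) = sets borel" "prob_space (L x)" "sets (L x) = sets borel" if "x \<in> space \<eta>" for x
    using measurable_space[OF K that] measurable_space[OF L that] by (auto simp: space_prob_algebra)
  have \<rho>m: "j \<in> borel_measurable (\<rho> x)" if "x \<in> space \<eta>" "j \<in> borel_measurable borel" for x and j :: "'b \<Rightarrow> ennreal"
    unfolding measurable_cong_sets[OF \<rho>x(2)[OF that(1)] refl] by (rule that(2))
  have sec: "(\<lambda>u. h (x, u)) \<in> borel_measurable borel"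
    if "x \<in> space \<eta>" "h \<in> borel_measurable (\<eta> \<Otimes>\<^sub>M borel)" for x and h :: "'a \<times> 'b \<Rightarrow> ennreal"
    using that by measurable
  have one: "(\<integral>\<^sup>+u. f (x, u) \<partial>\<rho> x) = 1" "(\<integral>\<^sup>+u. g (x, u) \<partial>\<rho> x) = 1" if x: "x \<in> space \<eta>" for x
  proof -
    interpret \<rho>x: prob_space "\<rho> x" by (rule \<rho>x(1)[OF x])
    interpret Kx: prob_space "K x" by (rule Kx(1)[OF x])
    interpret Lx: prob_space "L x" by (rule Kx(3)[OF x])
    have "(\<integral>\<^sup>+u. f (x, u) \<partial>\<rho> x) = 1 \<and> (\<integral>\<^sup>+u. g (x, u) \<partial>\<rho> x) = 1"
    proof (cases "x \<in> Z")
      case True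
      then show ?thesis by (simp add: f_def g_def \<rho>x.emeasure_space_1)
    next
      case False
      have "(\<integral>\<^sup>+u. f (x, u) \<partial>\<rho> x) = emeasure (K x) (space (K x))"
        "(\<integral>\<^sup>+u. g (x, u) \<partial>\<rho> x) = emeasure (L x) (space (L x))"
        unfolding KL[OF x False] using \<rho>m[OF x sec[OF x f]] \<rho>m[OF x sec[OF x g]]
        by (auto simp: emeasure_density intro!: nn_integral_cong)
      then show ?thesis by (simp add: Kx.emeasure_space_1 Lx.emeasure_space_1)
    qed
    then show "(\<integral>\<^sup>+u. f (x, u) \<partial>\<rho> x) = 1" "(\<integral>\<^sup>+u. g (x, u) \<partial>\<rho> x) = 1" by auto
  qed
  define C where "C x = (if x \<in> Z then K x \<Otimes>\<^sub>M L x else dens_coupling (\<rho> x) (\<lambda>u. f (x, u)) (\<lambda>u. g (x, u)))" for x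
  define Y where "Y = {p \<in> space (\<eta> \<Otimes>\<^sub>M borel). g p \<le> f p}"
  show ?thesis
  proof (rule that)
    show "C \<in> \<eta> \<rightarrow>\<^sub>M prob_algebra (borel \<Otimes>\<^sub>M borel)"
      unfolding C_def[abs_def]
      using dens_coupling_measurable[OF \<rho> f g one] measurable_pair_prob[OF K L] by measurable
    show "C x \<in> Cpl (K x) (L x)" if x: "x \<in> space \<eta>" for x
      using Cpl_pair_measure[OF Kx(1,3)[OF x]]
        dens_coupling_Cpl[OF \<rho>x(1)[OF x] \<rho>m[OF x sec[OF x f]] \<rho>m[OF x sec[OF x g]] one[OF x]]
      by (cases "x \<in> Z") (simp_all add: C_def KL[OF x])
    show Y[measurable]: "Y \<in> sets (\<eta> \<Otimes>\<^sub>M borel)" unfolding Y_def by measurable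
    fix h :: "'a \<times> 'b \<Rightarrow> ennreal" assume h[measurable]: "h \<in> borel_measurable (\<eta> \<Otimes>\<^sub>M borel)"
    let ?E = "\<lambda>x. \<integral>\<^sup>+z. (h (x, fst z) + h (x, snd z)) * indicator {z. fst z \<noteq> snd z} z \<partial>C x"
    let ?IY = "\<lambda>M x. \<integral>\<^sup>+u. h (x, u) * indicator Y (x, u) \<partial>(M x :: 'b measure)"
    let ?IN = "\<lambda>M x. \<integral>\<^sup>+u. h (x, u) * indicator (- Y) (x, u) \<partial>(M x :: 'b measure)"
    have diag: "Measurable.pred (borel \<Otimes>\<^sub>M borel) (\<lambda>z::'b \<times> 'b. fst z = snd z)"
    proof -
      have "closed {z::'b \<times> 'b. fst z = snd z}" by (intro closed_Collect_eq continuous_intros)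
      then have "{z::'b \<times> 'b. fst z = snd z} \<in> sets (borel \<Otimes>\<^sub>M borel)" unfolding borel_prod by simp
      then show ?thesis by (simp add: pred_def space_pair_measure)
    qed
    have NY: "(\<lambda>p. h p * indicator (- Y) p) \<in> borel_measurable (\<eta> \<Otimes>\<^sub>M borel)"
      "(\<lambda>p. h p * indicator Y p) \<in> borel_measurable (\<eta> \<Otimes>\<^sub>M borel)"
      subgoal by measurable
      subgoal by measurable
      done
    have mes: "?IY M \<in> borel_measurable \<eta>" "?IN M \<in> borel_measurable \<eta>" if "M \<in> \<eta> \<rightarrow>\<^sub>M subprob_algebra borel" for M
      by (rule nn_integral_measurable_subprob_algebra2[OF _ that]; use NY in simp)+
    have pt: "?E x + ?IY L x + ?IN K x \<le> ?IY K x + ?IN L x" if x: "x \<in> space \<eta>" "x \<notin> Z" for x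
    proof -
      interpret \<rho>x: prob_space "\<rho> x" by (rule \<rho>x(1)[OF x(1)])
      note [measurable] = \<rho>m[OF x(1) sec[OF x(1) f]] \<rho>m[OF x(1) sec[OF x(1) g]] \<rho>m[OF x(1) sec[OF x(1) h]]
        \<rho>m[OF x(1) sec[OF x(1) NY(1)]] \<rho>m[OF x(1) sec[OF x(1) NY(2)]]
      have in_Y: "(x, u) \<in> Y \<longleftrightarrow> g (x, u) \<le> f (x, u)" for u
        using x by (simp add: Y_def space_pair_measure)
      have d: "Measurable.pred (\<rho> x \<Otimes>\<^sub>M \<rho> x) (\<lambda>z. fst z = snd z)"
        using diag \<rho>x(2)[OF x(1)] by (simp cong: measurable_cong_sets sets_pair_measure_cong)
      have "?E x \<le> (\<integral>\<^sup>+u. (f (x, u) - g (x, u)) * h (x, u) \<partial>\<rho> x) + (\<integral>\<^sup>+u. (g (x, u) - f (x, u)) * h (x, u) \<partial>\<rho> x)"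
        unfolding C_def using x(2)
        by (simp, intro dens_coupling_off_diagonal[OF \<rho>x(1)[OF x(1)] _ _ one[OF x(1)] _ d]) measurable
      then have "?E x + ?IY L x + ?IN K x \<le> (\<integral>\<^sup>+u. (f (x, u) - g (x, u)) * h (x, u) \<partial>\<rho> x) + (\<integral>\<^sup>+u. (g (x, u) - f (x, u)) * h (x, u) \<partial>\<rho> x)
         + ?IY L x + ?IN K x" by (intro add_right_mono)
      also have "\<dots> = (\<integral>\<^sup>+u. (f (x, u) - g (x, u)) * h (x, u) + (g (x, u) - f (x, u)) * h (x, u)
          + g (x, u) * (h (x, u) * indicator Y (x, u)) + f (x, u) * (h (x, u) * indicator (- Y) (x, u)) \<partial>\<rho> x)"
        unfolding KL[OF x] by (simp add: nn_integral_density nn_integral_add)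
      also have "\<dots> = (\<integral>\<^sup>+u. f (x, u) * (h (x, u) * indicator Y (x, u)) + g (x, u) * (h (x, u) * indicator (- Y) (x, u)) \<partial>\<rho> x)"
      proof (rule nn_integral_cong)
        fix u
        show "(f (x, u) - g (x, u)) * h (x, u) + (g (x, u) - f (x, u)) * h (x, u)
          + g (x, u) * (h (x, u) * indicator Y (x, u)) + f (x, u) * (h (x, u) * indicator (- Y) (x, u))
          = f (x, u) * (h (x, u) * indicator Y (x, u)) + g (x, u) * (h (x, u) * indicator (- Y) (x, u))"
          using arg_cong[OF excess_split_ennreal[of "f (x, u)" "g (x, u)"], of "\<lambda>a. a * h (x, u)"]
          by (cases "g (x, u) \<le> f (x, u)") (simp_all add: in_Y distrib_right)
      qed
      also have "\<dots> = ?IY K x + ?IN L x"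
        unfolding KL[OF x] by (simp add: nn_integral_density nn_integral_add)
      finally show ?thesis .
    qed
    have Em: "?E \<in> borel_measurable \<eta>"
    proof (rule nn_integral_measurable_subprob_algebra2[OF _ measurable_prob_algebraD])
      show "C \<in> \<eta> \<rightarrow>\<^sub>M prob_algebra (borel \<Otimes>\<^sub>M borel)" by fact
      show "(\<lambda>(x, z). (h (x, fst z) + h (x, snd z)) * indicator {z. fst z \<noteq> snd z} z) \<in> borel_measurable (\<eta> \<Otimes>\<^sub>M (borel \<Otimes>\<^sub>M borel))"
        using diag unfolding split_beta' by measurable
    qed
    have "(\<integral>\<^sup>+x. ?E x \<partial>\<eta>) + (\<integral>\<^sup>+x. ?IY L x \<partial>\<eta>) + (\<integral>\<^sup>+x. ?IN K x \<partial>\<eta>) = (\<integral>\<^sup>+x. ?E x + ?IY L x + ?IN K x \<partial>\<eta>)"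
      using Em mes[OF K'] mes[OF L'] by (simp add: nn_integral_add)
    also have "\<dots> \<le> (\<integral>\<^sup>+x. ?IY K x + ?IN L x \<partial>\<eta>)"
      using AE_not_in[OF Z] pt by (intro nn_integral_mono_AE) (auto elim!: AE_mp)
    also have "\<dots> = (\<integral>\<^sup>+x. ?IY K x \<partial>\<eta>) + (\<integral>\<^sup>+x. ?IN L x \<partial>\<eta>)"
      using mes[OF K'] mes[OF L'] by (simp add: nn_integral_add)
    finally show "(\<integral>\<^sup>+x. ?E x \<partial>\<eta>) + (\<integral>\<^sup>+x. ?IY L x \<partial>\<eta>) + (\<integral>\<^sup>+x. ?IN K x \<partial>\<eta>) \<le> (\<integral>\<^sup>+x. ?IY K x \<partial>\<eta>) + (\<integral>\<^sup>+x. ?IN L x \<partial>\<eta>)" .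
  qed
qed

section \<open>Total variation\<close>

text \<open>
  Inequalities between measures, tested on sets, pass to nonnegative integrals.
\<close>

lemma nn_integral_le_add_of_emeasure:
  assumes s: "sets B = sets A" "sets C = sets A"
    and le: "\<And>X. X \<in> sets A \<Longrightarrow> emeasure A X \<le> emeasure B X + emeasure C X"
  shows "(\<integral>\<^sup>+x. h x \<partial>A) \<le> (\<integral>\<^sup>+x. h x \<partial>B) + (\<integral>\<^sup>+x. h x \<partial>C)"
  unfolding nn_integral_def[of A]
proof (rule SUP_least, clarify)
  fix g assume g: "simple_function A g" "g \<le> h"
  have sp: "space B = space A" "space C = space A" using s by (auto dest: sets_eq_imp_space_eq)
  have gB: "simple_function B g" "simple_function C g"
    using g(1) s sp by (auto simp: simple_function_def)
  have "integral\<^sup>S A g \<le> integral\<^sup>S B g + integral\<^sup>S C g"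
    unfolding simple_integral_def sp sum.distrib[symmetric] distrib_left[symmetric]
    using simple_functionD(2)[OF g(1)] by (intro sum_mono mult_left_mono le) auto
  also have "\<dots> = (\<integral>\<^sup>+x. g x \<partial>B) + (\<integral>\<^sup>+x. g x \<partial>C)"
    using gB by (simp add: nn_integral_eq_simple_integral)
  also have "\<dots> \<le> (\<integral>\<^sup>+x. h x \<partial>B) + (\<integral>\<^sup>+x. h x \<partial>C)"
    using g(2) by (intro add_mono nn_integral_mono) (auto simp: le_fun_def)
  finally show "integral\<^sup>S A g \<le> (\<integral>\<^sup>+x. h x \<partial>B) + (\<integral>\<^sup>+x. h x \<partial>C)" .
qed

lemma sets_abs_diff: "sets (abs_diff M N) = sets M"
  by (simp add: abs_diff_def)

lemma meet_measure_le:
  assumes M: "finite_measure M" and N: "finite_measure N" and S: "sets N = sets M" and A: "A \<in> sets M"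
  shows "emeasure (meet_measure M N) A \<le> emeasure M A" "emeasure (meet_measure M N) A \<le> emeasure N A"
proof -
  interpret M: finite_measure M by fact
  note eq = emeasure_meet_measure[OF M N S A]
  show "emeasure (meet_measure M N) A \<le> emeasure M A" unfolding eq by (rule diff_le_self_ennreal)
  have "emeasure M A - emeasure N A \<le> emeasure (pos_part_diff M N) A"
    unfolding emeasure_pos_part_diff[OF M N S A] using A by (intro SUP_upper) auto
  then have "emeasure M A \<le> emeasure (pos_part_diff M N) A + emeasure N A"
    by (simp add: ennreal_minus_le_iff add.commute)
  then show "emeasure (meet_measure M N) A \<le> emeasure N A"
    unfolding eq by (subst ennreal_minus_le_iff) auto
qed

lemma nn_integral_le_abs_diff:
  assumes M: "finite_measure M" and N: "finite_measure N" and S: "sets N = sets M"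
  shows "(\<integral>\<^sup>+x. h x \<partial>M) \<le> (\<integral>\<^sup>+x. h x \<partial>N) + (\<integral>\<^sup>+x. h x \<partial>abs_diff M N)"
    and "(\<integral>\<^sup>+x. h x \<partial>N) \<le> (\<integral>\<^sup>+x. h x \<partial>M) + (\<integral>\<^sup>+x. h x \<partial>abs_diff M N)"
proof -
  interpret M: finite_measure M by fact
  interpret N: finite_measure N by fact
  have aux: "a \<le> b + (a + b - 2 * m)" if "m \<le> b" "b < \<top>" for a b m :: ennreal
  proof -
    have "b + a \<le> 2 * m + (a + b - 2 * m)" by (metis add.commute add_diff_self_ennreal order.refl linear)
    also have "\<dots> \<le> 2 * b + (a + b - 2 * m)" using that by (intro add_right_mono mult_left_mono) auto
    also have "\<dots> = b + (b + (a + b - 2 * m))" by (simp add: mult_2 add.assoc)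
    finally show ?thesis using that(2) by (auto simp: ennreal_add_left_cancel_le)
  qed
  show "(\<integral>\<^sup>+x. h x \<partial>M) \<le> (\<integral>\<^sup>+x. h x \<partial>N) + (\<integral>\<^sup>+x. h x \<partial>abs_diff M N)"
    by (rule nn_integral_le_add_of_emeasure)
       (auto simp: S sets_abs_diff emeasure_abs_diff[OF M N S] less_top[symmetric] intro!: aux meet_measure_le[OF M N S])
  show "(\<integral>\<^sup>+x. h x \<partial>N) \<le> (\<integral>\<^sup>+x. h x \<partial>M) + (\<integral>\<^sup>+x. h x \<partial>abs_diff M N)"
  proof (rule nn_integral_le_add_of_emeasure)
    fix X assume "X \<in> sets N"
    then have X: "X \<in> sets M" using S by simp
    show "emeasure N X \<le> emeasure M X + emeasure (abs_diff M N) X"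
      unfolding emeasure_abs_diff[OF M N S X] add.commute[of "emeasure M X" "emeasure N X"]
      by (rule aux[OF meet_measure_le(1)[OF M N S X]]) (simp add: less_top[symmetric])
  qed (auto simp: S sets_abs_diff)
qed

text \<open>
  Pushing two measures forward does not increase their total variation distance: the supremum that
  defines the positive part then runs over fewer sets.
\<close>

lemma emeasure_abs_diff_distr_le:
  assumes M: "finite_measure M" and N: "finite_measure N" and S: "sets N = sets M"
    and \<phi>: "\<phi> \<in> M \<rightarrow>\<^sub>M M'" and A: "A \<in> sets M'"
  shows "emeasure (abs_diff (distr M M' \<phi>) (distr N M' \<phi>)) A \<le> emeasure (abs_diff M N) (\<phi> -` A \<inter> space M)"
proof -
  have \<phi>N: "\<phi> \<in> N \<rightarrow>\<^sub>M M'" using \<phi> S by (simp cong: measurable_cong_sets)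
  have sp: "space N = space M" using S by (rule sets_eq_imp_space_eq)
  let ?M = "distr M M' \<phi>" and ?N = "distr N M' \<phi>" and ?A = "\<phi> -` A \<inter> space M"
  have f: "finite_measure ?M" "finite_measure ?N"
    using finite_measure.finite_measure_distr[OF M \<phi>] finite_measure.finite_measure_distr[OF N \<phi>N] by auto
  have s: "sets ?N = sets ?M" and A': "A \<in> sets ?M" and PA: "?A \<in> sets M"
    using A \<phi> by auto
  have e: "emeasure ?M B = emeasure M (\<phi> -` B \<inter> space M)" "emeasure ?N B = emeasure N (\<phi> -` B \<inter> space M)" if "B \<in> sets M'" for B
    using that \<phi> \<phi>N sp by (auto simp: emeasure_distr)
  have "emeasure (pos_part_diff ?M ?N) A \<le> emeasure (pos_part_diff M N) ?A"
    unfolding emeasure_pos_part_diff[OF f s A'] emeasure_pos_part_diff[OF M N S PA]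
  proof (rule SUP_least)
    fix B assume B: "B \<in> {B \<in> sets ?M. B \<subseteq> A}"
    then have "\<phi> -` B \<inter> space M \<in> {B \<in> sets M. B \<subseteq> ?A}" using \<phi> by auto
    then show "emeasure ?M B - emeasure ?N B \<le> (SUP B\<in>{B \<in> sets M. B \<subseteq> ?A}. emeasure M B - emeasure N B)"
      using B by (auto simp: e intro: SUP_upper2)
  qed
  then have "emeasure (meet_measure M N) ?A \<le> emeasure (meet_measure ?M ?N) A"
    unfolding emeasure_meet_measure[OF f s A'] emeasure_meet_measure[OF M N S PA]
    using A by (simp add: e ennreal_mono_minus)
  then show ?thesis
    unfolding emeasure_abs_diff[OF f s A'] emeasure_abs_diff[OF M N S PA]
    using A by (auto simp: e intro!: ennreal_mono_minus mult_left_mono)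
qed

lemma nn_integral_abs_diff_distr_le:
  assumes M: "finite_measure M" and N: "finite_measure N" and S: "sets N = sets M"
    and \<phi>: "\<phi> \<in> M \<rightarrow>\<^sub>M M'" and h: "h \<in> borel_measurable M'"
  shows "(\<integral>\<^sup>+x. h x \<partial>abs_diff (distr M M' \<phi>) (distr N M' \<phi>)) \<le> (\<integral>\<^sup>+x. h (\<phi> x) \<partial>abs_diff M N)"
proof -
  have \<phi>': "\<phi> \<in> abs_diff M N \<rightarrow>\<^sub>M M'" using \<phi> by (simp add: sets_abs_diff cong: measurable_cong_sets)
  have sp: "space (abs_diff M N) = space M" by (rule sets_eq_imp_space_eq) (rule sets_abs_diff)
  let ?D = "abs_diff (distr M M' \<phi>) (distr N M' \<phi>)"
  have "(\<integral>\<^sup>+x. h x \<partial>?D) \<le> (\<integral>\<^sup>+x. h x \<partial>distr (abs_diff M N) M' \<phi>) + (\<integral>\<^sup>+x. h x \<partial>null_measure ?D)"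
    by (rule nn_integral_le_add_of_emeasure)
       (auto simp: sets_abs_diff emeasure_distr[OF \<phi>'] sp intro!: emeasure_abs_diff_distr_le[OF M N S \<phi>])
  also have "(\<integral>\<^sup>+x. h x \<partial>null_measure ?D) = 0" by simp
  finally show ?thesis using h by (simp add: nn_integral_distr[OF \<phi>'])
qed

section \<open>Paths and their truncations\<close>

lemma space_paths: "space (paths t) = extensional {1..t}"
  by (auto simp: paths_def space_PiM PiE_def)

lemma measurable_coord [measurable]: "s \<in> {1..t} \<Longrightarrow> (\<lambda>x. x s) \<in> paths t \<rightarrow>\<^sub>M borel"
  unfolding paths_def by (rule measurable_component_singleton)

lemma measurable_init [measurable]: "s \<le> t \<Longrightarrow> init s \<in> paths t \<rightarrow>\<^sub>M paths s"
  unfolding paths_def init_def[abs_def] by (rule measurable_restrict_subset) auto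

lemma measurable_path_norm [measurable]: "path_norm t \<in> borel_measurable (paths t)"
  unfolding path_norm_def[abs_def]
  by (intro borel_measurable_sum measurable_compose[OF measurable_coord borel_measurable_norm]) auto

lemma measurable_extend_path [measurable]:
  "(\<lambda>p. (fst p)(Suc t := snd p)) \<in> paths t \<Otimes>\<^sub>M borel \<rightarrow>\<^sub>M paths (Suc t)"
proof -
  have "insert (Suc t) {1..t} = {1..Suc t}" by auto
  then show ?thesis
    using measurable_add_dim[of "Suc t" "{1..t}" "\<lambda>_. borel"] by (simp add: paths_def split_beta')
qed

lemma path_norm_extend: "path_norm (Suc t) (x(Suc t := v)) = path_norm t x + norm v"
  by (simp add: path_norm_def)

lemma path_norm_nonneg: "0 \<le> path_norm t x"
  by (simp add: path_norm_def sum_nonneg)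

lemma path_norm_init: "path_norm s (init s x) = path_norm s x"
  by (simp add: path_norm_def init_def)

lemma path_norm_Suc: "path_norm (Suc t) x = path_norm t x + norm (x (Suc t))"
  by (simp add: path_norm_def)

lemma init_init: "s \<le> t \<Longrightarrow> init s (init t x) = init s x"
  by (auto simp: init_def restrict_def)

lemma init_extend: "x \<in> space (paths t) \<Longrightarrow> init t (x(Suc t := v)) = x"
  by (auto simp: init_def space_paths restrict_def extensional_def)

lemma extend_init: "x \<in> space (paths (Suc t)) \<Longrightarrow> (init t x)(Suc t := x (Suc t)) = x"
  by (rule ext) (auto simp: init_def space_paths restrict_def extensional_def not_le le_Suc_eq)

lemma measurable_diagonal_paths [measurable]:
  "Measurable.pred (paths t \<Otimes>\<^sub>M paths t) (\<lambda>z. fst z = snd (z :: (nat \<Rightarrow> real ^ 'd) \<times> (nat \<Rightarrow> real ^ 'd)))"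
proof -
  have "Measurable.pred (paths t \<Otimes>\<^sub>M paths t) (\<lambda>z. \<forall>s\<in>{1..t}. fst z s = (snd z s :: real ^ 'd))"
  proof (rule pred_intros_finite)
    fix s assume "s \<in> {1..t}"
    note [measurable] = measurable_compose[OF measurable_fst measurable_coord[OF this]]
      measurable_compose[OF measurable_snd measurable_coord[OF this]]
    show "Measurable.pred (paths t \<Otimes>\<^sub>M paths t) (\<lambda>z. fst z s = (snd z s :: real ^ 'd))"
      by measurable
  qed simp
  then show ?thesis
    by (rule measurable_cong[THEN iffD1, rotated])
       (auto simp: space_pair_measure space_paths intro: extensionalityI)
qed

lemma TV1_init_le:
  assumes "\<mu> \<in> P1 (Suc t)" "\<nu> \<in> P1 (Suc t)"
  shows "TV1 t (distr \<mu> (paths t) (init t)) (distr \<nu> (paths t) (init t)) \<le> TV1 (Suc t) \<mu> \<nu>"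
proof -
  have s: "sets \<mu> = sets (paths (Suc t))" "sets \<nu> = sets (paths (Suc t))" "prob_space \<mu>" "prob_space \<nu>"
    using assms by (auto simp: P1_def space_prob_algebra)
  have f: "finite_measure \<mu>" "finite_measure \<nu>" using s by (auto simp: prob_space_def)
  have "init t \<in> \<mu> \<rightarrow>\<^sub>M paths t" using s by (simp cong: measurable_cong_sets)
  then have "TV1 t (distr \<mu> (paths t) (init t)) (distr \<nu> (paths t) (init t))
      \<le> (\<integral>\<^sup>+x. ennreal (path_norm t (init t x) + 1 / 2) \<partial>abs_diff \<mu> \<nu>)"
    unfolding TV1_def using s by (intro nn_integral_abs_diff_distr_le f) auto
  also have "\<dots> \<le> TV1 (Suc t) \<mu> \<nu>"
    unfolding TV1_def by (intro nn_integral_mono ennreal_leI) (simp add: path_norm_init path_norm_Suc)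
  finally show ?thesis .
qed

section \<open>Extending a bicausal coupling by one step\<close>

lemma is_cond_law_kernel_prod:
  assumes P: "prob_space P" and s: "sets P = sets N" and K: "K \<in> N \<rightarrow>\<^sub>M prob_algebra L"
  shows "is_cond_law (kernel_prod P L K) N fst L snd K" "distr (kernel_prod P L K) N fst = P"
proof -
  interpret prob_space P by fact
  have KP: "K \<in> P \<rightarrow>\<^sub>M prob_algebra L" using K by (simp cong: measurable_cong_sets add: s)
  have sp: "space P = space N" using s by (rule sets_eq_imp_space_eq)
  have ss: "sets (kernel_prod P L K) = sets (N \<Otimes>\<^sub>M L)"
    unfolding sets_kernel_prod[OF KP not_empty] by (intro sets_pair_measure_cong s) simp
  then have ssp: "space (kernel_prod P L K) = space N \<times> space L"
    using sets_eq_imp_space_eq[OF ss] by (simp add: space_pair_measure)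
  have m: "fst \<in> kernel_prod P L K \<rightarrow>\<^sub>M N" "snd \<in> kernel_prod P L K \<rightarrow>\<^sub>M L"
    by (simp_all add: ss cong: measurable_cong_sets)
  show dP: "distr (kernel_prod P L K) N fst = P"
  proof (rule measure_eqI)
    fix A assume "A \<in> sets (distr (kernel_prod P L K) N fst)"
    then have A: "A \<in> sets P" by (simp add: s)
    have "emeasure (distr (kernel_prod P L K) N fst) A = emeasure (kernel_prod P L K) (A \<times> space L)"
      using A s sets.sets_into_space[OF A]
      by (subst emeasure_distr[OF m(1)]) (auto simp: ssp sp intro!: arg_cong2[where f=emeasure])
    also have "\<dots> = (\<integral>\<^sup>+x. emeasure (K x) (space L) * indicator A x \<partial>P)"
      by (rule emeasure_kernel_prod_Times[OF KP not_empty A]) simp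
    also have "\<dots> = (\<integral>\<^sup>+x. indicator A x \<partial>P)"
    proof (rule nn_integral_cong)
      fix x assume "x \<in> space P"
      then have Kx: "prob_space (K x)" "space (K x) = space L"
        using measurable_space[OF KP] by (auto simp: space_prob_algebra dest: sets_eq_imp_space_eq)
      then show "emeasure (K x) (space L) * indicator A x = (indicator A x :: ennreal)"
        using prob_space.emeasure_space_1[OF Kx(1)] by simp
    qed
    finally show "emeasure (distr (kernel_prod P L K) N fst) A = emeasure P A" using A by simp
  qed (simp add: s)
  show "is_cond_law (kernel_prod P L K) N fst L snd K"
    unfolding is_cond_law_def dP
  proof (intro conjI m K ballI)
    fix A B assume AB: "A \<in> sets N" "B \<in> sets L"
    have "{\<omega> \<in> space (kernel_prod P L K). fst \<omega> \<in> A \<and> snd \<omega> \<in> B} = A \<times> B"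
      using AB[THEN sets.sets_into_space] by (auto simp: ssp)
    then show "emeasure (kernel_prod P L K) {\<omega> \<in> space (kernel_prod P L K). fst \<omega> \<in> A \<and> snd \<omega> \<in> B}
      = (\<integral>\<^sup>+x. emeasure (K x) B * indicator A x \<partial>P)"
      using AB s by (simp add: emeasure_kernel_prod_Times[OF KP not_empty])
  qed
qed

lemma nn_integral_Cpl:
  assumes "\<pi> \<in> Cpl M N"
  shows "h \<in> borel_measurable M \<Longrightarrow> (\<integral>\<^sup>+z. h (fst z) \<partial>\<pi>) = (\<integral>\<^sup>+x. h x \<partial>M)"
    and "h' \<in> borel_measurable N \<Longrightarrow> (\<integral>\<^sup>+z. h' (snd z) \<partial>\<pi>) = (\<integral>\<^sup>+y. h' y \<partial>N)"
proof -
  have s: "sets \<pi> = sets (M \<Otimes>\<^sub>M N)" and d: "distr \<pi> M fst = M" "distr \<pi> N snd = N"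
    using assms by (auto simp: Cpl_def space_prob_algebra)
  have m: "fst \<in> \<pi> \<rightarrow>\<^sub>M M" "snd \<in> \<pi> \<rightarrow>\<^sub>M N" by (simp_all add: s cong: measurable_cong_sets)
  show "h \<in> borel_measurable M \<Longrightarrow> (\<integral>\<^sup>+z. h (fst z) \<partial>\<pi>) = (\<integral>\<^sup>+x. h x \<partial>M)"
    using nn_integral_distr[OF m(1), of h] d(1) by simp
  show "h' \<in> borel_measurable N \<Longrightarrow> (\<integral>\<^sup>+z. h' (snd z) \<partial>\<pi>) = (\<integral>\<^sup>+y. h' y \<partial>N)"
    using nn_integral_distr[OF m(2), of h'] d(2) by simp
qed

lemma P1_D:
  assumes "\<mu> \<in> P1 T"
  shows "sets \<mu> = sets (paths T)" "prob_space \<mu>" "space \<mu> = space (paths T)"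
    "(\<integral>\<^sup>+ x. ennreal (path_norm T x) \<partial>\<mu>) < \<infinity>"
  using assms by (auto simp: P1_def space_prob_algebra dest: sets_eq_imp_space_eq)

text \<open>
  The law of \<open>x\<^sub>1, \<dots>, x\<^sub>t\<close> under \<open>\<mu>\<close>.
\<close>

abbreviation trunc :: "nat \<Rightarrow> (nat \<Rightarrow> real ^ 'd) measure \<Rightarrow> (nat \<Rightarrow> real ^ 'd) measure" where
  "trunc t \<mu> \<equiv> distr \<mu> (paths t) (init t)"

lemma is_kernel_trunc:
  assumes "sets \<mu> = sets (paths T)" "s < t" "t \<le> T"
  shows "is_kernel (trunc t \<mu>) s K \<longleftrightarrow> is_kernel \<mu> s K"
  unfolding is_kernel_def
proof (rule is_cond_law_distr)
  show "init t \<in> \<mu> \<rightarrow>\<^sub>M paths t" using assms by (simp cong: measurable_cong_sets)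
qed (use assms in \<open>auto simp: init_init init_def\<close>)

lemma nn_integral_kernel:
  fixes \<mu> :: "(nat \<Rightarrow> real ^ 'd) measure"
  assumes s: "sets \<mu> = sets (paths (Suc t))" and P: "prob_space \<mu>" and K: "is_kernel \<mu> t K"
    and F[measurable]: "F \<in> borel_measurable (paths (Suc t))"
  shows "(\<integral>\<^sup>+x. F x \<partial>\<mu>) = (\<integral>\<^sup>+x. \<integral>\<^sup>+v. F (x(Suc t := v)) \<partial>K x \<partial>trunc t \<mu>)"
proof -
  have sp: "space \<mu> = space (paths (Suc t))" using s by (rule sets_eq_imp_space_eq)
  have "(\<integral>\<^sup>+x. F x \<partial>\<mu>) = (\<integral>\<^sup>+x. F ((fst (init t x, x (t + 1)))(Suc t := snd (init t x, x (t + 1)))) \<partial>\<mu>)"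
    by (intro nn_integral_cong) (simp add: extend_init sp)
  also have "\<dots> = (\<integral>\<^sup>+x. \<integral>\<^sup>+v. F ((fst (x, v))(Suc t := snd (x, v))) \<partial>K x \<partial>trunc t \<mu>)"
    by (rule nn_integral_cond_law[OF K[unfolded is_kernel_def] P])
       (rule measurable_compose[OF measurable_extend_path F])
  finally show ?thesis by simp
qed

text \<open>
  Appends the pair \<open>w\<close> of values at time \<open>t + 1\<close> to the pair \<open>z\<close> of paths of length \<open>t\<close>.
\<close>

definition extend_pair :: "nat \<Rightarrow> ((nat \<Rightarrow> real ^ 'd) \<times> (nat \<Rightarrow> real ^ 'd)) \<times> ((real ^ 'd) \<times> (real ^ 'd)) \<Rightarrow>
    (nat \<Rightarrow> real ^ 'd) \<times> (nat \<Rightarrow> real ^ 'd)" where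
  "extend_pair t = (\<lambda>(z, w). ((fst z)(Suc t := fst w), (snd z)(Suc t := snd w)))"

lemma measurable_extend_pair [measurable]:
  "extend_pair t \<in> (paths t \<Otimes>\<^sub>M paths t) \<Otimes>\<^sub>M (borel \<Otimes>\<^sub>M borel) \<rightarrow>\<^sub>M paths (Suc t) \<Otimes>\<^sub>M paths (Suc t)"
proof -
  have "(\<lambda>p. (fst (fst (fst p), fst (snd p)))(Suc t := snd (fst (fst p), fst (snd p))))
      \<in> (paths t \<Otimes>\<^sub>M paths t) \<Otimes>\<^sub>M (borel \<Otimes>\<^sub>M borel) \<rightarrow>\<^sub>M paths (Suc t)"
    by (rule measurable_compose[OF _ measurable_extend_path]) measurable
  moreover have "(\<lambda>p. (fst (snd (fst p), snd (snd p)))(Suc t := snd (snd (fst p), snd (snd p))))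
      \<in> (paths t \<Otimes>\<^sub>M paths t) \<Otimes>\<^sub>M (borel \<Otimes>\<^sub>M borel) \<rightarrow>\<^sub>M paths (Suc t)"
    by (rule measurable_compose[OF _ measurable_extend_path]) measurable
  ultimately show ?thesis
    unfolding extend_pair_def split_beta' by (intro measurable_Pair) simp_all
qed

text \<open>
  A bicausal coupling of the truncated laws, followed by a kernel \<open>J\<close> that couples the conditional
  laws of the next step, is a bicausal coupling. The kernels for the earlier times are inherited,
  because the truncation of the new coupling is the old one.
\<close>

lemma Cpl_bc_extend:
  fixes \<mu> \<nu> :: "(nat \<Rightarrow> real ^ 'd) measure"
  assumes \<mu>: "\<mu> \<in> P1 (Suc t)" and \<nu>: "\<nu> \<in> P1 (Suc t)"
    and K: "is_kernel \<mu> t K" and L: "is_kernel \<nu> t L"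
    and \<pi>': "\<pi>' \<in> Cpl_bc t (trunc t \<mu>) (trunc t \<nu>)"
    and J: "J \<in> paths t \<Otimes>\<^sub>M paths t \<rightarrow>\<^sub>M prob_algebra (borel \<Otimes>\<^sub>M borel)"
    and JC: "\<And>z. z \<in> space (paths t \<Otimes>\<^sub>M paths t) \<Longrightarrow> J z \<in> Cpl (K (fst z)) (L (snd z))"
  obtains \<pi> where "\<pi> \<in> Cpl_bc (Suc t) \<mu> \<nu>"
    "\<And>F. F \<in> borel_measurable (paths (Suc t) \<Otimes>\<^sub>M paths (Suc t)) \<Longrightarrow>
      (\<integral>\<^sup>+z. F z \<partial>\<pi>) = (\<integral>\<^sup>+z. \<integral>\<^sup>+w. F (extend_pair t (z, w)) \<partial>J z \<partial>\<pi>')"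
proof -
  let ?N = "paths t :: (nat \<Rightarrow> real ^ 'd) measure" and ?M = "paths (Suc t) :: (nat \<Rightarrow> real ^ 'd) measure"
  let ?B = "borel \<Otimes>\<^sub>M borel :: ((real ^ 'd) \<times> (real ^ 'd)) measure"
  note \<mu>D = P1_D[OF \<mu>] and \<nu>D = P1_D[OF \<nu>]
  have C': "\<pi>' \<in> Cpl (trunc t \<mu>) (trunc t \<nu>)" using \<pi>' by (simp add: Cpl_bc_def)
  then have s': "sets \<pi>' = sets (?N \<Otimes>\<^sub>M ?N)" and P': "prob_space \<pi>'"
    by (auto simp: Cpl_def space_prob_algebra cong: sets_pair_measure_cong)
  have sp': "space \<pi>' = space (?N \<Otimes>\<^sub>M ?N)" using s' by (rule sets_eq_imp_space_eq)
  interpret P': prob_space \<pi>' by fact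
  have J': "J \<in> \<pi>' \<rightarrow>\<^sub>M prob_algebra ?B" using J by (simp add: s' cong: measurable_cong_sets)
  define Q where "Q = kernel_prod \<pi>' ?B J"
  have sQ: "sets Q = sets ((?N \<Otimes>\<^sub>M ?N) \<Otimes>\<^sub>M ?B)"
    unfolding Q_def sets_kernel_prod[OF J' P'.not_empty] by (intro sets_pair_measure_cong s' refl)
  then have spQ: "space Q = space ((?N \<Otimes>\<^sub>M ?N) \<Otimes>\<^sub>M ?B)" by (rule sets_eq_imp_space_eq)
  have ext: "extend_pair t \<in> Q \<rightarrow>\<^sub>M ?M \<Otimes>\<^sub>M ?M"
    using measurable_extend_pair by (simp add: sQ cong: measurable_cong_sets)
  define \<pi> where "\<pi> = distr Q (?M \<Otimes>\<^sub>M ?M) (extend_pair t)"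
  have clQ: "is_cond_law Q (?N \<Otimes>\<^sub>M ?N) fst ?B snd J" and dQ: "distr Q (?N \<Otimes>\<^sub>M ?N) fst = \<pi>'"
    unfolding Q_def by (rule is_cond_law_kernel_prod[OF P' s' J])+
  have int: "(\<integral>\<^sup>+z. F z \<partial>\<pi>) = (\<integral>\<^sup>+z. \<integral>\<^sup>+w. F (extend_pair t (z, w)) \<partial>J z \<partial>\<pi>')"
    if F[measurable]: "F \<in> borel_measurable (?M \<Otimes>\<^sub>M ?M)" for F
  proof -
    have "(\<lambda>p. F (extend_pair t p)) \<in> borel_measurable ((?N \<Otimes>\<^sub>M ?N) \<Otimes>\<^sub>M ?B)" by measurable
    then have "(\<lambda>p. F (extend_pair t p)) \<in> borel_measurable (\<pi>' \<Otimes>\<^sub>M ?B)"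
      by (simp add: s' cong: measurable_cong_sets sets_pair_measure_cong)
    from nn_integral_kernel_prod[OF J' this] show ?thesis
      unfolding \<pi>_def by (simp add: nn_integral_distr[OF ext] flip: Q_def)
  qed
  have s\<pi>: "sets \<pi> = sets (?M \<Otimes>\<^sub>M ?M)" by (simp add: \<pi>_def)
  have sp\<pi>: "space \<pi> = space (?M \<Otimes>\<^sub>M ?M)" by (simp add: \<pi>_def)
  have m\<pi>: "fst \<in> \<pi> \<rightarrow>\<^sub>M \<mu>" "snd \<in> \<pi> \<rightarrow>\<^sub>M \<nu>"
    by (simp_all add: s\<pi> \<mu>D \<nu>D cong: measurable_cong_sets)
  have "emeasure \<pi> (space \<pi>) = (\<integral>\<^sup>+z. \<integral>\<^sup>+w. 1 \<partial>J z \<partial>\<pi>')"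
    using int[of "\<lambda>_. 1"] by simp
  also have "\<dots> = (\<integral>\<^sup>+z. 1 \<partial>\<pi>')"
    using measurable_space[OF J']
    by (intro nn_integral_cong) (auto simp: space_prob_algebra prob_space.emeasure_space_1)
  finally have P: "prob_space \<pi>" by (intro prob_spaceI) (simp add: P'.emeasure_space_1)
  have KN: "K \<in> ?N \<rightarrow>\<^sub>M prob_algebra borel" and LN: "L \<in> ?N \<rightarrow>\<^sub>M prob_algebra borel"
    using K L by (auto simp: is_kernel_def dest: is_cond_lawD)
  have upd: "(\<lambda>v. F (x(Suc t := v))) \<in> borel_measurable borel"
    if "x \<in> space ?N" "F \<in> borel_measurable ?M" for F :: "(nat \<Rightarrow> real ^ 'd) \<Rightarrow> ennreal" and x
  proof -
    have "(\<lambda>v. F ((fst (x, v))(Suc t := snd (x, v)))) \<in> borel_measurable borel"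
      using that by (intro measurable_compose[OF _ measurable_compose[OF measurable_extend_path that(2)]]) simp
    then show ?thesis by simp
  qed
  have inner_m: "(\<lambda>x. \<integral>\<^sup>+u. F (x(Suc t := u)) \<partial>R x) \<in> borel_measurable ?N"
    if "F \<in> borel_measurable ?M" "R \<in> ?N \<rightarrow>\<^sub>M prob_algebra borel" for F :: "(nat \<Rightarrow> real ^ 'd) \<Rightarrow> ennreal" and R
    using measurable_compose[OF measurable_extend_path that(1)]
    by (intro nn_integral_measurable_subprob_algebra2[OF _ measurable_prob_algebraD[OF that(2)]]) (simp add: split_beta')
  have d1: "distr \<pi> \<mu> fst = \<mu>"
  proof (rule measure_eqI)
    fix A assume "A \<in> sets (distr \<pi> \<mu> fst)"
    then have A[measurable]: "A \<in> sets ?M" and A\<mu>: "A \<in> sets \<mu>" using \<mu>D by auto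
    let ?F = "indicator A :: (nat \<Rightarrow> real ^ 'd) \<Rightarrow> ennreal"
    have "emeasure (distr \<pi> \<mu> fst) A = (\<integral>\<^sup>+z. ?F (fst z) \<partial>\<pi>)"
      using A\<mu> nn_integral_distr[OF m\<pi>(1), of ?F] by simp
    also have "\<dots> = (\<integral>\<^sup>+z. \<integral>\<^sup>+w. ?F (fst (extend_pair t (z, w))) \<partial>J z \<partial>\<pi>')" by (rule int) measurable
    also have "\<dots> = (\<integral>\<^sup>+z. \<integral>\<^sup>+u. ?F ((fst z)(Suc t := u)) \<partial>K (fst z) \<partial>\<pi>')"
    proof (rule nn_integral_cong)
      fix z assume z: "z \<in> space \<pi>'"
      then have "fst z \<in> space ?N" by (auto simp: sp' space_pair_measure)
      then have "(\<lambda>u. ?F ((fst z)(Suc t := u))) \<in> borel_measurable (K (fst z))"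
        unfolding subprob_measurableD(3)[OF measurable_prob_algebraD[OF KN] \<open>fst z \<in> space ?N\<close>]
        by (intro upd) measurable
      from nn_integral_Cpl(1)[OF JC this] z
      show "(\<integral>\<^sup>+w. ?F (fst (extend_pair t (z, w))) \<partial>J z) = (\<integral>\<^sup>+u. ?F ((fst z)(Suc t := u)) \<partial>K (fst z))"
        by (simp add: extend_pair_def sp')
    qed
    also have "\<dots> = (\<integral>\<^sup>+x. \<integral>\<^sup>+u. ?F (x(Suc t := u)) \<partial>K x \<partial>trunc t \<mu>)"
      using inner_m[OF _ KN, of ?F] by (intro nn_integral_Cpl(1)[OF C']) simp
    also have "\<dots> = (\<integral>\<^sup>+x. ?F x \<partial>\<mu>)"
      by (rule nn_integral_kernel[OF \<mu>D(1,2) K, symmetric]) measurable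
    finally show "emeasure (distr \<pi> \<mu> fst) A = emeasure \<mu> A" using A\<mu> by simp
  qed simp
  have d2: "distr \<pi> \<nu> snd = \<nu>"
  proof (rule measure_eqI)
    fix A assume "A \<in> sets (distr \<pi> \<nu> snd)"
    then have A[measurable]: "A \<in> sets ?M" and A\<nu>: "A \<in> sets \<nu>" using \<nu>D by auto
    let ?F = "indicator A :: (nat \<Rightarrow> real ^ 'd) \<Rightarrow> ennreal"
    have "emeasure (distr \<pi> \<nu> snd) A = (\<integral>\<^sup>+z. ?F (snd z) \<partial>\<pi>)"
      using A\<nu> nn_integral_distr[OF m\<pi>(2), of ?F] by simp
    also have "\<dots> = (\<integral>\<^sup>+z. \<integral>\<^sup>+w. ?F (snd (extend_pair t (z, w))) \<partial>J z \<partial>\<pi>')" by (rule int) measurable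
    also have "\<dots> = (\<integral>\<^sup>+z. \<integral>\<^sup>+u. ?F ((snd z)(Suc t := u)) \<partial>L (snd z) \<partial>\<pi>')"
    proof (rule nn_integral_cong)
      fix z assume z: "z \<in> space \<pi>'"
      then have "snd z \<in> space ?N" by (auto simp: sp' space_pair_measure)
      then have "(\<lambda>u. ?F ((snd z)(Suc t := u))) \<in> borel_measurable (L (snd z))"
        unfolding subprob_measurableD(3)[OF measurable_prob_algebraD[OF LN] \<open>snd z \<in> space ?N\<close>]
        by (intro upd) measurable
      from nn_integral_Cpl(2)[OF JC this] z
      show "(\<integral>\<^sup>+w. ?F (snd (extend_pair t (z, w))) \<partial>J z) = (\<integral>\<^sup>+u. ?F ((snd z)(Suc t := u)) \<partial>L (snd z))"
        by (simp add: extend_pair_def sp')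
    qed
    also have "\<dots> = (\<integral>\<^sup>+x. \<integral>\<^sup>+u. ?F (x(Suc t := u)) \<partial>L x \<partial>trunc t \<nu>)"
      using inner_m[OF _ LN, of ?F] by (intro nn_integral_Cpl(2)[OF C']) simp
    also have "\<dots> = (\<integral>\<^sup>+x. ?F x \<partial>\<nu>)"
      by (rule nn_integral_kernel[OF \<nu>D(1,2) L, symmetric]) measurable
    finally show "emeasure (distr \<pi> \<nu> snd) A = emeasure \<nu> A" using A\<nu> by simp
  qed simp
  have Cpl\<pi>: "\<pi> \<in> Cpl \<mu> \<nu>"
    using P d1 d2 s\<pi> by (simp add: Cpl_def space_prob_algebra \<mu>D \<nu>D cong: sets_pair_measure_cong)
  have coord: "(\<lambda>z. (fst z (Suc t), snd z (Suc t))) \<in> ?M \<Otimes>\<^sub>M ?M \<rightarrow>\<^sub>M ?B"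
    by (intro measurable_Pair measurable_compose[OF measurable_fst measurable_coord]
        measurable_compose[OF measurable_snd measurable_coord]) auto
  have initm: "(\<lambda>z. (init s (fst z), init s (snd z))) \<in> paths r \<Otimes>\<^sub>M paths r \<rightarrow>\<^sub>M paths s \<Otimes>\<^sub>M paths s" if "s \<le> r" for r s
    using that by measurable
  have last: "is_kernel2 \<pi> t J"
    unfolding is_kernel2_def \<pi>_def split_beta'
  proof (subst is_cond_law_distr[OF ext _ _ _ _, where X'=fst and Y'=snd])
    show "(\<lambda>z. (init t (fst z), init t (snd z))) \<in> ?M \<Otimes>\<^sub>M ?M \<rightarrow>\<^sub>M ?N \<Otimes>\<^sub>M ?N" by (rule initm) simp
    show "(\<lambda>z. (fst z (t + 1), snd z (t + 1))) \<in> ?M \<Otimes>\<^sub>M ?M \<rightarrow>\<^sub>M ?B" using coord by simp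
  qed (use clQ in \<open>auto simp: spQ space_pair_measure extend_pair_def init_extend\<close>)
  have \<pi>'_eq: "\<pi>' = distr \<pi> (?N \<Otimes>\<^sub>M ?N) (\<lambda>z. (init t (fst z), init t (snd z)))"
  proof -
    have "distr \<pi> (?N \<Otimes>\<^sub>M ?N) (\<lambda>z. (init t (fst z), init t (snd z))) = distr Q (?N \<Otimes>\<^sub>M ?N) fst"
      unfolding \<pi>_def
      by (subst distr_distr[OF initm ext])
         (auto intro!: distr_cong simp: spQ space_pair_measure extend_pair_def init_extend)
    then show ?thesis using dQ by simp
  qed
  have ipm: "(\<lambda>z. (init t (fst z), init t (snd z))) \<in> \<pi> \<rightarrow>\<^sub>M ?N \<Otimes>\<^sub>M ?N"
    using initm[of t "Suc t"] by (simp add: s\<pi> cong: measurable_cong_sets)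
  have bc: "\<exists>K\<^sub>\<mu> K\<^sub>\<nu> K\<^sub>\<pi>. is_kernel \<mu> s K\<^sub>\<mu> \<and> is_kernel \<nu> s K\<^sub>\<nu> \<and> is_kernel2 \<pi> s K\<^sub>\<pi> \<and>
       (AE (x, y) in \<pi>. K\<^sub>\<pi> (init s x, init s y) \<in> Cpl (K\<^sub>\<mu> (init s x)) (K\<^sub>\<nu> (init s y)))"
    if s: "s \<in> {1..<Suc t}" for s
  proof (cases "s = t")
    case True
    have "AE (x, y) in \<pi>. J (init s x, init s y) \<in> Cpl (K (init s x)) (L (init s y))"
      using measurable_space[OF ipm] JC True by (intro AE_I2) (fastforce simp: split_beta')
    then show ?thesis using K L last True by blast
  next
    case False
    then have st: "s \<in> {1..<t}" "s < t" using s by auto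
    then obtain K1 K2 K3 where k: "is_kernel (trunc t \<mu>) s K1" "is_kernel (trunc t \<nu>) s K2" "is_kernel2 \<pi>' s K3"
      and ae: "AE (x, y) in \<pi>'. K3 (init s x, init s y) \<in> Cpl (K1 (init s x)) (K2 (init s y))"
      using \<pi>' unfolding Cpl_bc_def by blast
    have "is_kernel \<mu> s K1" "is_kernel \<nu> s K2"
      using k(1,2) is_kernel_trunc[OF \<mu>D(1) st(2)] is_kernel_trunc[OF \<nu>D(1) st(2)] by auto
    moreover have "is_kernel2 \<pi> s K3"
    proof -
      have c: "(\<lambda>z. (fst z (s + 1), snd z (s + 1))) \<in> ?N \<Otimes>\<^sub>M ?N \<rightarrow>\<^sub>M ?B"
        using st by (intro measurable_Pair measurable_compose[OF measurable_fst measurable_coord]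
        measurable_compose[OF measurable_snd measurable_coord]) auto
      show ?thesis
        using k(3) unfolding is_kernel2_def split_beta' \<pi>'_eq
        by (subst (asm) is_cond_law_distr[OF ipm initm c,
              where X'="\<lambda>z. (init s (fst z), init s (snd z))" and Y'="\<lambda>z. (fst z (s + 1), snd z (s + 1))"])
           (use st in \<open>auto simp: init_init init_def\<close>)
    qed
    moreover have "AE (x, y) in \<pi>. K3 (init s x, init s y) \<in> Cpl (K1 (init s x)) (K2 (init s y))"
      using AE_distrD[OF ipm ae[unfolded \<pi>'_eq]] st by (simp add: split_beta' init_init)
    ultimately show ?thesis by blast
  qed
  have "\<pi> \<in> Cpl_bc (Suc t) \<mu> \<nu>" unfolding Cpl_bc_def using Cpl\<pi> bc by blast
  then show ?thesis using int by (rule that)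
qed

section \<open>The cost of separation\<close>

text \<open>
  The cost whose infimum over all couplings is the weighted total variation distance. It dominates
  the transport cost, since \<open>\<parallel>x - y\<parallel> \<le> (\<parallel>x\<parallel> + \<parallel>y\<parallel> + 1) 1\<^bsub>x \<noteq> y\<^esub>\<close>, and unlike the latter it controls the error made
  at later times once the paths have separated.
\<close>

definition off_diag_cost :: "nat \<Rightarrow> ((nat \<Rightarrow> real ^ 'd) \<times> (nat \<Rightarrow> real ^ 'd)) measure \<Rightarrow> ennreal" where
  "off_diag_cost t \<pi> = (\<integral>\<^sup>+z. ennreal (path_norm t (fst z) + path_norm t (snd z) + 1) * indicator {z. fst z \<noteq> snd z} z \<partial>\<pi>)"

text \<open>
  The cost of separating at time \<open>t + 1\<close>. Let \<open>\<eta>\<close> be the law of the common path on the event that the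
  paths agree up to time \<open>t\<close>, and \<open>C\<close> the maximal coupling of the conditional laws. The cost is at most
  \<open>\<integral> h d|\<eta> \<otimes> K - \<eta> \<otimes> L|\<close> with \<open>h (x, v) = \<parallel>x\<parallel> + \<parallel>v\<parallel> + 1/2\<close>. Replacing \<open>\<eta> \<otimes> K\<close> by \<open>\<mu>\<close> and \<open>\<eta> \<otimes> L\<close> by \<open>\<nu>\<close> produces
  \<open>TV1 (Suc t) \<mu> \<nu>\<close> and error terms carried by the paths that have already separated; the latter are bounded by
  the moment condition.
\<close>

lemma off_diagonal_estimate:
  fixes \<mu> \<nu> :: "(nat \<Rightarrow> real ^ 'd) measure"
  assumes \<mu>: "\<mu> \<in> P1 (Suc t)" and \<nu>: "\<nu> \<in> P1 (Suc t)"
    and K: "is_kernel \<mu> t K" and L: "is_kernel \<nu> t L"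
    and Kb: "\<And>x. x \<in> space (paths t) \<Longrightarrow> (\<integral>\<^sup>+v. ennreal (norm v) \<partial>K x) \<le> a * ennreal (path_norm t x + 1)"
    and Lb: "\<And>x. x \<in> space (paths t) \<Longrightarrow> (\<integral>\<^sup>+v. ennreal (norm v) \<partial>L x) \<le> a * ennreal (path_norm t x + 1)"
    and \<pi>': "\<pi>' \<in> Cpl (trunc t \<mu>) (trunc t \<nu>)"
  obtains C where "C \<in> paths t \<rightarrow>\<^sub>M prob_algebra (borel \<Otimes>\<^sub>M borel)"
    "\<And>x. x \<in> space (paths t) \<Longrightarrow> C x \<in> Cpl (K x) (L x)"
    "(\<integral>\<^sup>+z. (\<integral>\<^sup>+w. ennreal (2 * path_norm t (fst z) + norm (fst w) + norm (snd w) + 1) * indicator {w. fst w \<noteq> snd w} w \<partial>C (fst z))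
         * indicator {z. fst z = snd z} z \<partial>\<pi>')
      \<le> (1 + 2 * a) * off_diag_cost t \<pi>' + TV1 (Suc t) \<mu> \<nu>"
proof -
  let ?N = "paths t :: (nat \<Rightarrow> real ^ 'd) measure" and ?M = "paths (Suc t) :: (nat \<Rightarrow> real ^ 'd) measure"
  note \<mu>D = P1_D[OF \<mu>] and \<nu>D = P1_D[OF \<nu>]
  have s': "sets \<pi>' = sets (?N \<Otimes>\<^sub>M ?N)" and P': "prob_space \<pi>'"
    using \<pi>' by (auto simp: Cpl_def space_prob_algebra cong: sets_pair_measure_cong)
  have sp': "space \<pi>' = space (?N \<Otimes>\<^sub>M ?N)" using s' by (rule sets_eq_imp_space_eq)
  interpret P': prob_space \<pi>' by fact
  have KN: "K \<in> ?N \<rightarrow>\<^sub>M prob_algebra borel" and LN: "L \<in> ?N \<rightarrow>\<^sub>M prob_algebra borel"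
    using K L by (auto simp: is_kernel_def dest: is_cond_lawD)
  let ?eq = "indicator {z. fst z = snd z} :: (nat \<Rightarrow> real ^ 'd) \<times> (nat \<Rightarrow> real ^ 'd) \<Rightarrow> ennreal"
  let ?ne = "indicator {z. fst z \<noteq> snd z} :: (nat \<Rightarrow> real ^ 'd) \<times> (nat \<Rightarrow> real ^ 'd) \<Rightarrow> ennreal"
  have "?eq \<in> borel_measurable (?N \<Otimes>\<^sub>M ?N)" "?ne \<in> borel_measurable (?N \<Otimes>\<^sub>M ?N)" by measurable
  then have eqm[measurable]: "?eq \<in> borel_measurable \<pi>'" and nem[measurable]: "?ne \<in> borel_measurable \<pi>'"
    by (simp_all add: s' cong: measurable_cong_sets)
  have fst_m[measurable]: "fst \<in> \<pi>' \<rightarrow>\<^sub>M ?N" and snd_m[measurable]: "snd \<in> \<pi>' \<rightarrow>\<^sub>M ?N"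
    by (simp_all add: s' cong: measurable_cong_sets)
  define \<eta> where "\<eta> = distr (density \<pi>' ?eq) ?N fst"
  have s\<eta>: "sets \<eta> = sets ?N" and sp\<eta>: "space \<eta> = space ?N" by (simp_all add: \<eta>_def)
  have \<eta>_int: "(\<integral>\<^sup>+x. G x \<partial>\<eta>) = (\<integral>\<^sup>+z. G (fst z) * ?eq z \<partial>\<pi>')" if [measurable]: "G \<in> borel_measurable ?N" for G
    unfolding \<eta>_def by (simp add: nn_integral_distr nn_integral_density mult.commute)
  have "emeasure \<eta> (space \<eta>) = (\<integral>\<^sup>+z. 1 * ?eq z \<partial>\<pi>')" using \<eta>_int[of "\<lambda>_. 1"] by simp
  also have "\<dots> \<le> (\<integral>\<^sup>+z. 1 \<partial>\<pi>')" by (intro nn_integral_mono) (simp add: indicator_def)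
  finally have fin_\<eta>: "finite_measure \<eta>"
    by (intro finite_measureI) (auto simp: P'.emeasure_space_1 top_unique)
  have "K \<in> \<eta> \<rightarrow>\<^sub>M prob_algebra borel" "L \<in> \<eta> \<rightarrow>\<^sub>M prob_algebra borel"
    using KN LN by (simp_all add: s\<eta> cong: measurable_cong_sets)
  then obtain C Y where C\<eta>: "C \<in> \<eta> \<rightarrow>\<^sub>M prob_algebra (borel \<Otimes>\<^sub>M borel)"
    and C_Cpl: "\<And>x. x \<in> space \<eta> \<Longrightarrow> C x \<in> Cpl (K x) (L x)"
    and Y\<eta>: "Y \<in> sets (\<eta> \<Otimes>\<^sub>M borel)"
    and C_le: "\<And>h. h \<in> borel_measurable (\<eta> \<Otimes>\<^sub>M borel) \<Longrightarrow>
      (\<integral>\<^sup>+x. \<integral>\<^sup>+z. (h (x, fst z) + h (x, snd z)) * indicator {z. fst z \<noteq> snd z} z \<partial>C x \<partial>\<eta>)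
        + (\<integral>\<^sup>+x. \<integral>\<^sup>+u. h (x, u) * indicator Y (x, u) \<partial>L x \<partial>\<eta>)
        + (\<integral>\<^sup>+x. \<integral>\<^sup>+u. h (x, u) * indicator (- Y) (x, u) \<partial>K x \<partial>\<eta>)
      \<le> (\<integral>\<^sup>+x. \<integral>\<^sup>+u. h (x, u) * indicator Y (x, u) \<partial>K x \<partial>\<eta>)
        + (\<integral>\<^sup>+x. \<integral>\<^sup>+u. h (x, u) * indicator (- Y) (x, u) \<partial>L x \<partial>\<eta>)"
    by (rule maximal_kernel_coupling[OF fin_\<eta>]) blast
  have CN: "C \<in> ?N \<rightarrow>\<^sub>M prob_algebra (borel \<Otimes>\<^sub>M borel)"
    using C\<eta> by (simp add: s\<eta> cong: measurable_cong_sets)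
  have Y[measurable]: "Y \<in> sets (?N \<Otimes>\<^sub>M borel)"
    using Y\<eta> by (simp add: s\<eta> cong: sets_pair_measure_cong)
  define h where "h p = ennreal (path_norm t (fst p) + norm (snd p) + 1 / 2)" for p :: "(nat \<Rightarrow> real ^ 'd) \<times> (real ^ 'd)"
  have h[measurable]: "h \<in> borel_measurable (?N \<Otimes>\<^sub>M borel)" unfolding h_def[abs_def] by measurable
  then have h\<eta>: "h \<in> borel_measurable (\<eta> \<Otimes>\<^sub>M borel)" by (simp add: s\<eta> cong: measurable_cong_sets sets_pair_measure_cong)
  have hY[measurable]: "(\<lambda>p. h p * indicator Y p) \<in> borel_measurable (?N \<Otimes>\<^sub>M borel)"
    and hN[measurable]: "(\<lambda>p. h p * indicator (- Y) p) \<in> borel_measurable (?N \<Otimes>\<^sub>M borel)"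
    subgoal by measurable
    subgoal by measurable
    done
  let ?I = "\<lambda>R Z x. \<integral>\<^sup>+u. h (x, u) * indicator Z (x, u) \<partial>(R x :: (real ^ 'd) measure)"
  have Im: "?I R Z \<in> borel_measurable ?N" if "R \<in> ?N \<rightarrow>\<^sub>M prob_algebra borel" "(\<lambda>p. h p * indicator Z p) \<in> borel_measurable (?N \<Otimes>\<^sub>M borel)" for R Z
    using that(2) by (intro nn_integral_measurable_subprob_algebra2[OF _ measurable_prob_algebraD[OF that(1)]]) (simp add: split_beta')
  define H where "H x = ennreal (path_norm (Suc t) x + 1 / 2)" for x :: "nat \<Rightarrow> real ^ 'd"
  have H[measurable]: "H \<in> borel_measurable ?M" unfolding H_def[abs_def] by measurable
  define W where "W = {x \<in> space ?M. (init t x, x (Suc t)) \<in> Y}"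
  have p[measurable]: "(\<lambda>x. (init t x, x (Suc t))) \<in> ?M \<rightarrow>\<^sub>M ?N \<Otimes>\<^sub>M borel"
    by (intro measurable_Pair measurable_init measurable_coord) auto
  have W[measurable]: "W \<in> sets ?M" unfolding W_def by measurable
  have law: "(\<integral>\<^sup>+x. H x * indicator (if b then W else - W) x \<partial>\<xi>) = (\<integral>\<^sup>+x. ?I R (if b then Y else - Y) x \<partial>trunc t \<xi>)"
    if "\<xi> \<in> P1 (Suc t)" "is_kernel \<xi> t R" for \<xi> R b
  proof -
    have "(\<lambda>x. H x * indicator (if b then W else - W) x) \<in> borel_measurable ?M" by (cases b) (simp_all, measurable)
    from nn_integral_kernel[OF P1_D(1,2)[OF that(1)] that(2) this]
    have "(\<integral>\<^sup>+x. H x * indicator (if b then W else - W) x \<partial>\<xi>) =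
       (\<integral>\<^sup>+x. \<integral>\<^sup>+v. H (x(Suc t := v)) * indicator (if b then W else - W) (x(Suc t := v)) \<partial>R x \<partial>trunc t \<xi>)" .
    also have "\<dots> = (\<integral>\<^sup>+x. ?I R (if b then Y else - Y) x \<partial>trunc t \<xi>)"
    proof (intro nn_integral_cong)
      fix x v assume "x \<in> space (trunc t \<xi>)"
      then have x: "x \<in> space ?N" by simp
      have "x(Suc t := v) \<in> space ?M" using x by (auto simp: space_paths extensional_def)
      then have "x(Suc t := v) \<in> W \<longleftrightarrow> (x, v) \<in> Y" using x by (simp add: W_def init_extend)
      then show "H (x(Suc t := v)) * indicator (if b then W else - W) (x(Suc t := v)) = h (x, v) * indicator (if b then Y else - Y) (x, v)"
        by (simp add: H_def h_def path_norm_extend indicator_def)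
    qed
    finally show ?thesis .
  qed
  have split: "(\<integral>\<^sup>+z. G (f z) \<partial>\<pi>') = (\<integral>\<^sup>+z. G (f z) * ?eq z \<partial>\<pi>') + (\<integral>\<^sup>+z. G (f z) * ?ne z \<partial>\<pi>')"
    if "G \<in> borel_measurable ?N" "f \<in> \<pi>' \<rightarrow>\<^sub>M ?N" for G f
  proof -
    have Gf: "(\<lambda>z. G (f z)) \<in> borel_measurable \<pi>'" using that by measurable
    show ?thesis
      unfolding nn_integral_add[OF borel_measurable_times_ennreal[OF Gf eqm] borel_measurable_times_ennreal[OF Gf nem], symmetric]
      by (intro nn_integral_cong) (simp add: indicator_def)
  qed
  \<comment> \<open>The \<open>\<mu>\<close>-integral splits into a part on agreeing pairs, which is an \<open>\<eta>\<close>-integral, and a part on separated pairs.\<close>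
  have lawK: "(\<integral>\<^sup>+x. H x * indicator (if b then W else - W) x \<partial>\<mu>) =
      (\<integral>\<^sup>+x. ?I K (if b then Y else - Y) x \<partial>\<eta>) + (\<integral>\<^sup>+z. ?I K (if b then Y else - Y) (fst z) * ?ne z \<partial>\<pi>')" for b
  proof -
    have m: "?I K (if b then Y else - Y) \<in> borel_measurable ?N" by (cases b) (simp_all add: Im[OF KN] hY hN)
    show ?thesis
      unfolding law[OF \<mu> K] \<eta>_int[OF m]
      using m by (subst nn_integral_Cpl(1)[OF \<pi>', symmetric]) (simp_all add: split[OF m fst_m])
  qed
  have lawL: "(\<integral>\<^sup>+x. H x * indicator (if b then W else - W) x \<partial>\<nu>) =
      (\<integral>\<^sup>+x. ?I L (if b then Y else - Y) x \<partial>\<eta>) + (\<integral>\<^sup>+z. ?I L (if b then Y else - Y) (snd z) * ?ne z \<partial>\<pi>')" for b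
  proof -
    have m: "?I L (if b then Y else - Y) \<in> borel_measurable ?N" by (cases b) (simp_all add: Im[OF LN] hY hN)
    have "(\<integral>\<^sup>+z. ?I L (if b then Y else - Y) (fst z) * ?eq z \<partial>\<pi>') = (\<integral>\<^sup>+z. ?I L (if b then Y else - Y) (snd z) * ?eq z \<partial>\<pi>')"
      by (intro nn_integral_cong) (auto simp: indicator_def)
    then show ?thesis
      unfolding law[OF \<nu> L] \<eta>_int[OF m]
      using m by (subst nn_integral_Cpl(2)[OF \<pi>', symmetric]) (simp_all add: split[OF m snd_m])
  qed
  have HD: "(\<integral>\<^sup>+x. H x * indicator W x \<partial>abs_diff \<mu> \<nu>) + (\<integral>\<^sup>+x. H x * indicator (- W) x \<partial>abs_diff \<mu> \<nu>) = TV1 (Suc t) \<mu> \<nu>"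
  proof -
    have "(\<lambda>x. H x * indicator W x) \<in> borel_measurable ?M" "(\<lambda>x. H x * indicator (- W) x) \<in> borel_measurable ?M"
      subgoal by measurable
      subgoal by measurable
      done
    then have "(\<lambda>x. H x * indicator W x) \<in> borel_measurable (abs_diff \<mu> \<nu>)" "(\<lambda>x. H x * indicator (- W) x) \<in> borel_measurable (abs_diff \<mu> \<nu>)"
      by (simp_all add: sets_abs_diff \<mu>D cong: measurable_cong_sets)
    then show ?thesis
      unfolding TV1_def by (subst nn_integral_add[symmetric]) (auto intro!: nn_integral_cong simp: indicator_def H_def)
  qed
  have fm: "finite_measure \<mu>" "finite_measure \<nu>" using \<mu>D(2) \<nu>D(2) by (auto simp: prob_space_def)
  have sets_eq: "sets \<nu> = sets \<mu>" using \<mu>D \<nu>D by simp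
  have Hfin: "(\<integral>\<^sup>+x. H x * indicator Z x \<partial>\<xi>) < \<top>" if \<xi>: "\<xi> \<in> P1 (Suc t)" for \<xi> Z
  proof -
    interpret \<xi>: prob_space \<xi> by (rule P1_D(2)[OF \<xi>])
    have m: "(\<lambda>x. ennreal (path_norm (Suc t) x)) \<in> borel_measurable \<xi>"
      using P1_D(1)[OF \<xi>] by (simp cong: measurable_cong_sets)
    have "(\<integral>\<^sup>+x. H x * indicator Z x \<partial>\<xi>) \<le> (\<integral>\<^sup>+x. ennreal (path_norm (Suc t) x) + 1 \<partial>\<xi>)"
    proof (rule nn_integral_mono)
      fix x
      have "H x \<le> ennreal (path_norm (Suc t) x + 1)" unfolding H_def by (intro ennreal_leI) simp
      then show "H x * indicator Z x \<le> ennreal (path_norm (Suc t) x) + 1"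
        by (simp add: indicator_def path_norm_nonneg)
    qed
    also have "\<dots> = (\<integral>\<^sup>+x. ennreal (path_norm (Suc t) x) \<partial>\<xi>) + 1"
      using m by (subst nn_integral_add) (auto simp: \<xi>.emeasure_space_1)
    also have "\<dots> < \<top>" using P1_D(4)[OF \<xi>] by simp
    finally show ?thesis .
  qed
  have moment: "?I R Z x \<le> ennreal (path_norm t x + 1 / 2) + a * ennreal (path_norm t x + 1)"
    if R: "R \<in> ?N \<rightarrow>\<^sub>M prob_algebra borel" and x: "x \<in> space ?N"
      and b: "(\<integral>\<^sup>+v. ennreal (norm v) \<partial>R x) \<le> a * ennreal (path_norm t x + 1)" for R Z x
  proof -
    have Rx: "prob_space (R x)" "sets (R x) = sets borel" using measurable_space[OF R x] by (auto simp: space_prob_algebra)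
    interpret Rx: prob_space "R x" by fact
    have m: "(\<lambda>v. ennreal (norm v)) \<in> borel_measurable (R x)" using Rx(2) by (simp cong: measurable_cong_sets)
    have "?I R Z x \<le> (\<integral>\<^sup>+v. ennreal (path_norm t x + 1 / 2) + ennreal (norm v) \<partial>R x)"
      by (intro nn_integral_mono) (auto simp: h_def indicator_def path_norm_nonneg ac_simps simp flip: ennreal_plus)
    also have "\<dots> = ennreal (path_norm t x + 1 / 2) + (\<integral>\<^sup>+v. ennreal (norm v) \<partial>R x)"
      using m by (subst nn_integral_add) (auto simp: Rx.emeasure_space_1)
    finally show ?thesis using b by (auto intro: order_trans add_left_mono)
  qed
  define E where "E = (\<integral>\<^sup>+x. \<integral>\<^sup>+z. (h (x, fst z) + h (x, snd z)) * indicator {z. fst z \<noteq> snd z} z \<partial>C x \<partial>\<eta>)"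
  define off where "off R Z f = (\<integral>\<^sup>+z. ?I R Z (f z) * ?ne z \<partial>\<pi>')" for R Z f
  define on where "on R Z = (\<integral>\<^sup>+x. ?I R Z x \<partial>\<eta>)" for R Z
  \<comment> \<open>Finiteness of the first moments permits the cancellation at the end of the following chain.\<close>
  have fin: "on L Y + on K (- Y) < \<top>"
    using Hfin[OF \<nu>, of W] Hfin[OF \<mu>, of "- W"] lawL[of True] lawK[of False] by (simp add: on_def)
  have "(on L Y + on K (- Y)) + E \<le> on K Y + on L (- Y)"
    using C_le[OF h\<eta>] by (simp add: E_def on_def ac_simps)
  also have "\<dots> \<le> (\<integral>\<^sup>+x. H x * indicator W x \<partial>\<mu>) + (\<integral>\<^sup>+x. H x * indicator (- W) x \<partial>\<nu>)"
    using lawK[of True] lawL[of False] by (intro add_mono) (simp_all add: on_def)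
  also have "\<dots> \<le> ((\<integral>\<^sup>+x. H x * indicator W x \<partial>\<nu>) + (\<integral>\<^sup>+x. H x * indicator W x \<partial>abs_diff \<mu> \<nu>))
      + ((\<integral>\<^sup>+x. H x * indicator (- W) x \<partial>\<mu>) + (\<integral>\<^sup>+x. H x * indicator (- W) x \<partial>abs_diff \<mu> \<nu>))"
    by (intro add_mono nn_integral_le_abs_diff[OF fm sets_eq])
  also have "\<dots> = (\<integral>\<^sup>+x. H x * indicator W x \<partial>\<nu>) + (\<integral>\<^sup>+x. H x * indicator (- W) x \<partial>\<mu>) + TV1 (Suc t) \<mu> \<nu>"
    unfolding HD[symmetric] by (simp add: ac_simps)
  also have "\<dots> = (on L Y + on K (- Y)) + (off L Y snd + off K (- Y) fst + TV1 (Suc t) \<mu> \<nu>)"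
    using lawL[of True] lawK[of False] by (simp add: on_def off_def ac_simps)
  finally have "E \<le> off L Y snd + off K (- Y) fst + TV1 (Suc t) \<mu> \<nu>"
    using fin by (auto simp: ennreal_add_left_cancel_le)
  also have "off L Y snd + off K (- Y) fst \<le> (1 + 2 * a) * off_diag_cost t \<pi>'"
  proof -
    have m: "(\<lambda>z. ?I L Y (snd z) * ?ne z) \<in> borel_measurable \<pi>'" "(\<lambda>z. ?I K (- Y) (fst z) * ?ne z) \<in> borel_measurable \<pi>'"
      using Im[OF LN hY] Im[OF KN hN] by measurable
    have "off L Y snd + off K (- Y) fst = (\<integral>\<^sup>+z. ?I L Y (snd z) * ?ne z + ?I K (- Y) (fst z) * ?ne z \<partial>\<pi>')"
      unfolding off_def using m by (simp add: nn_integral_add)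
    also have "\<dots> \<le> (\<integral>\<^sup>+z. (1 + 2 * a) * (ennreal (path_norm t (fst z) + path_norm t (snd z) + 1) * ?ne z) \<partial>\<pi>')"
    proof (rule nn_integral_mono)
      fix z assume "z \<in> space \<pi>'"
      then have z: "fst z \<in> space ?N" "snd z \<in> space ?N" by (auto simp: sp' space_pair_measure)
      let ?x = "path_norm t (fst z)" and ?y = "path_norm t (snd z)"
      have "?I L Y (snd z) + ?I K (- Y) (fst z) \<le> (ennreal (?y + 1 / 2) + a * ennreal (?y + 1)) + (ennreal (?x + 1 / 2) + a * ennreal (?x + 1))"
        by (intro add_mono moment KN LN z Kb Lb)
      also have "\<dots> = ennreal (?x + ?y + 1) + a * ennreal (?x + ?y + 2)"
      proof -
        have "ennreal (?x + ?y + 1) = ennreal (?y + 1 / 2) + ennreal (?x + 1 / 2)"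
          "ennreal (?x + ?y + 2) = ennreal (?y + 1) + ennreal (?x + 1)"
          by (subst ennreal_plus[symmetric]; simp add: path_norm_nonneg add_nonneg_nonneg)+
        then show ?thesis by (simp add: distrib_left ac_simps)
      qed
      also have "\<dots> \<le> ennreal (?x + ?y + 1) + a * (2 * ennreal (?x + ?y + 1))"
      proof -
        have "ennreal (?x + ?y + 2) \<le> ennreal (2 * (?x + ?y + 1))"
          using path_norm_nonneg[of t "fst z"] path_norm_nonneg[of t "snd z"] by (intro ennreal_leI) simp
        also have "\<dots> = 2 * ennreal (?x + ?y + 1)" by (subst ennreal_mult') simp_all
        finally show ?thesis by (intro add_left_mono mult_left_mono) auto
      qed
      also have "\<dots> = (1 + 2 * a) * ennreal (?x + ?y + 1)" by (simp add: distrib_right ac_simps)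
      finally show "?I L Y (snd z) * ?ne z + ?I K (- Y) (fst z) * ?ne z \<le> (1 + 2 * a) * (ennreal (?x + ?y + 1) * ?ne z)"
        by (simp add: indicator_def)
    qed
    also have "\<dots> = (1 + 2 * a) * off_diag_cost t \<pi>'"
      unfolding off_diag_cost_def
      by (rule nn_integral_cmult) (use fst_m snd_m nem in measurable)
    finally show ?thesis .
  qed
  finally have E_le: "E \<le> (1 + 2 * a) * off_diag_cost t \<pi>' + TV1 (Suc t) \<mu> \<nu>" by (simp add: add_right_mono)
  have "(\<integral>\<^sup>+z. (\<integral>\<^sup>+w. ennreal (2 * path_norm t (fst z) + norm (fst w) + norm (snd w) + 1) * indicator {w. fst w \<noteq> snd w} w \<partial>C (fst z))
         * ?eq z \<partial>\<pi>') = E"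
  proof -
    have hh: "h (x, u) + h (x, v) = ennreal (2 * path_norm t x + norm u + norm v + 1)" for x u v
      unfolding h_def by (subst ennreal_plus[symmetric]) (auto simp: path_norm_nonneg add_nonneg_nonneg algebra_simps)
    have d: "Measurable.pred (borel \<Otimes>\<^sub>M borel) (\<lambda>z::(real ^ 'd) \<times> (real ^ 'd). fst z = snd z)" by measurable
    have "(\<lambda>x. \<integral>\<^sup>+z. (h (x, fst z) + h (x, snd z)) * indicator {z. fst z \<noteq> snd z} z \<partial>C x) \<in> borel_measurable ?N"
      by (rule nn_integral_measurable_subprob_algebra2[OF _ measurable_prob_algebraD[OF CN]])
         (use d in \<open>unfold split_beta', measurable\<close>)
    from \<eta>_int[OF this] show ?thesis unfolding E_def by (simp add: hh)
  qed
  with E_le C_Cpl CN show ?thesis by (intro that[of C]) (simp_all add: sp\<eta>)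
qed

text \<open>
  One time step: pairs that agree are moved by the maximal coupling, pairs that have separated by
  the independent one. Each of the two cases contributes at most \<open>1 + 2 a\<close> times the old cost, and the
  first one also the total variation distance. The constant \<open>a\<close> is extended
  real, so that \<open>a = \<infinity>\<close> covers the first step, where no conditional moment bound is available.
\<close>

lemma Cpl_bc_step:
  fixes \<mu> \<nu> :: "(nat \<Rightarrow> real ^ 'd) measure"
  assumes \<mu>: "\<mu> \<in> P1 (Suc t)" and \<nu>: "\<nu> \<in> P1 (Suc t)"
    and K: "is_kernel \<mu> t K" and L: "is_kernel \<nu> t L"
    and Kb: "\<And>x. x \<in> space (paths t) \<Longrightarrow> (\<integral>\<^sup>+v. ennreal (norm v) \<partial>K x) \<le> a * ennreal (path_norm t x + 1)"
    and Lb: "\<And>x. x \<in> space (paths t) \<Longrightarrow> (\<integral>\<^sup>+v. ennreal (norm v) \<partial>L x) \<le> a * ennreal (path_norm t x + 1)"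
    and \<pi>': "\<pi>' \<in> Cpl_bc t (trunc t \<mu>) (trunc t \<nu>)"
  obtains \<pi> where "\<pi> \<in> Cpl_bc (Suc t) \<mu> \<nu>"
    "off_diag_cost (Suc t) \<pi> \<le> 2 * (1 + 2 * a) * off_diag_cost t \<pi>' + TV1 (Suc t) \<mu> \<nu>"
proof -
  let ?N = "paths t :: (nat \<Rightarrow> real ^ 'd) measure" and ?M = "paths (Suc t) :: (nat \<Rightarrow> real ^ 'd) measure"
  have c': "\<pi>' \<in> Cpl (trunc t \<mu>) (trunc t \<nu>)" using \<pi>' by (simp add: Cpl_bc_def)
  have s': "sets \<pi>' = sets (?N \<Otimes>\<^sub>M ?N)"
    using c' by (auto simp: Cpl_def space_prob_algebra cong: sets_pair_measure_cong)
  have sp': "space \<pi>' = space (?N \<Otimes>\<^sub>M ?N)" using s' by (rule sets_eq_imp_space_eq)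
  have KN: "K \<in> ?N \<rightarrow>\<^sub>M prob_algebra borel" and LN: "L \<in> ?N \<rightarrow>\<^sub>M prob_algebra borel"
    using K L by (auto simp: is_kernel_def dest: is_cond_lawD)
  have Rx: "prob_space (R x)" "sets (R x) = sets borel"
    if "R \<in> ?N \<rightarrow>\<^sub>M prob_algebra borel" "x \<in> space ?N" for R :: "(nat \<Rightarrow> real ^ 'd) \<Rightarrow> (real ^ 'd) measure" and x
    using measurable_space[OF that] by (auto simp: space_prob_algebra)
  obtain C where C: "C \<in> ?N \<rightarrow>\<^sub>M prob_algebra (borel \<Otimes>\<^sub>M borel)"
    and CC: "\<And>x. x \<in> space ?N \<Longrightarrow> C x \<in> Cpl (K x) (L x)"
    and C_le: "(\<integral>\<^sup>+z. (\<integral>\<^sup>+w. ennreal (2 * path_norm t (fst z) + norm (fst w) + norm (snd w) + 1) * indicator {w. fst w \<noteq> snd w} w \<partial>C (fst z))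
         * indicator {z. fst z = snd z} z \<partial>\<pi>')
      \<le> (1 + 2 * a) * off_diag_cost t \<pi>' + TV1 (Suc t) \<mu> \<nu>"
    by (rule off_diagonal_estimate[OF \<mu> \<nu> K L Kb Lb c']) blast+
  let ?E = "\<lambda>z. (\<integral>\<^sup>+w. ennreal (2 * path_norm t (fst z) + norm (fst w) + norm (snd w) + 1) * indicator {w. fst w \<noteq> snd w} w \<partial>C (fst z))
         * indicator {z. fst z = snd z} z"
  let ?D = "\<lambda>z. ennreal (path_norm t (fst z) + path_norm t (snd z) + 1) * indicator {z. fst z \<noteq> snd z} z"
  define J where "J z = (if fst z = snd z then C (fst z) else K (fst z) \<Otimes>\<^sub>M L (snd z))" for z
  have J: "J \<in> ?N \<Otimes>\<^sub>M ?N \<rightarrow>\<^sub>M prob_algebra (borel \<Otimes>\<^sub>M borel)"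
    unfolding J_def[abs_def]
    by (intro measurable_If measurable_compose[OF measurable_fst C]
        measurable_pair_prob[OF measurable_compose[OF measurable_fst KN] measurable_compose[OF measurable_snd LN]])
       (rule measurable_diagonal_paths[unfolded pred_def])
  have JC: "J z \<in> Cpl (K (fst z)) (L (snd z))" if z: "z \<in> space (?N \<Otimes>\<^sub>M ?N)" for z
  proof -
    have "fst z \<in> space ?N" "snd z \<in> space ?N" using z by (auto simp: space_pair_measure)
    then show ?thesis
      using CC[of "fst z"] Cpl_pair_measure[OF Rx(1)[OF KN] Rx(1)[OF LN]] by (auto simp: J_def)
  qed
  obtain \<pi> where \<pi>: "\<pi> \<in> Cpl_bc (Suc t) \<mu> \<nu>"
    and \<pi>_int: "\<And>F. F \<in> borel_measurable (?M \<Otimes>\<^sub>M ?M) \<Longrightarrow>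
      (\<integral>\<^sup>+z. F z \<partial>\<pi>) = (\<integral>\<^sup>+z. \<integral>\<^sup>+w. F (extend_pair t (z, w)) \<partial>J z \<partial>\<pi>')"
    by (rule Cpl_bc_extend[OF \<mu> \<nu> K L \<pi>' J JC]) blast+
  have Dm: "?D \<in> borel_measurable \<pi>'"
  proof -
    have "?D \<in> borel_measurable (?N \<Otimes>\<^sub>M ?N)" by measurable
    then show ?thesis by (simp add: s' cong: measurable_cong_sets)
  qed
  have Em: "?E \<in> borel_measurable \<pi>'"
  proof -
    have "(\<lambda>x. \<integral>\<^sup>+w. ennreal (2 * path_norm t x + norm (fst w) + norm (snd w) + 1) * indicator {w. fst w \<noteq> snd w} w \<partial>C x) \<in> borel_measurable ?N"
      by (rule nn_integral_measurable_subprob_algebra2[OF _ measurable_prob_algebraD[OF C]])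
         (unfold split_beta', measurable)
    note [measurable] = measurable_compose[OF measurable_fst this]
    have "?E \<in> borel_measurable (?N \<Otimes>\<^sub>M ?N)" by measurable
    then show ?thesis by (simp add: s' cong: measurable_cong_sets)
  qed
  have "off_diag_cost (Suc t) \<pi> = (\<integral>\<^sup>+z. \<integral>\<^sup>+w. (ennreal (path_norm (Suc t) (fst (extend_pair t (z, w))) + path_norm (Suc t) (snd (extend_pair t (z, w))) + 1)
      * indicator {z. fst z \<noteq> snd z} (extend_pair t (z, w))) \<partial>J z \<partial>\<pi>')"
    unfolding off_diag_cost_def by (rule \<pi>_int) measurable
  also have "\<dots> \<le> (\<integral>\<^sup>+z. ?E z + (1 + 2 * a) * ?D z \<partial>\<pi>')"
  proof (rule nn_integral_mono)
    fix z assume "z \<in> space \<pi>'"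
    then have zN: "z \<in> space (?N \<Otimes>\<^sub>M ?N)" and z: "fst z \<in> space ?N" "snd z \<in> space ?N"
      by (auto simp: sp' space_pair_measure)
    let ?x = "path_norm t (fst z)" and ?y = "path_norm t (snd z)"
    have eq_iff: "fst (extend_pair t (z, w)) = snd (extend_pair t (z, w)) \<longleftrightarrow> fst z = snd z \<and> fst w = snd w" for w
    proof
      assume eq: "fst (extend_pair t (z, w)) = snd (extend_pair t (z, w))"
      have "fst z = init t (fst (extend_pair t (z, w)))" "snd z = init t (snd (extend_pair t (z, w)))"
        "fst w = fst (extend_pair t (z, w)) (Suc t)" "snd w = snd (extend_pair t (z, w)) (Suc t)"
        using z by (simp_all add: extend_pair_def init_extend)
      then show "fst z = snd z \<and> fst w = snd w" using eq by simp
    qed (simp add: extend_pair_def)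
    show "(\<integral>\<^sup>+w. (ennreal (path_norm (Suc t) (fst (extend_pair t (z, w))) + path_norm (Suc t) (snd (extend_pair t (z, w))) + 1)
      * indicator {z. fst z \<noteq> snd z} (extend_pair t (z, w))) \<partial>J z) \<le> ?E z + (1 + 2 * a) * ?D z"
    proof (cases "fst z = snd z")
      case True
      have "(\<integral>\<^sup>+w. (ennreal (path_norm (Suc t) (fst (extend_pair t (z, w))) + path_norm (Suc t) (snd (extend_pair t (z, w))) + 1)
        * indicator {z. fst z \<noteq> snd z} (extend_pair t (z, w))) \<partial>J z) = ?E z"
        using True by (auto simp: J_def indicator_def eq_iff intro!: nn_integral_cong)
           (auto simp: extend_pair_def path_norm_extend algebra_simps)
      then show ?thesis by simp
    next
      case False
      have Jz: "prob_space (J z)" "sets (J z) = sets (borel \<Otimes>\<^sub>M borel)"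
        using measurable_space[OF J zN] by (auto simp: space_prob_algebra)
      interpret Jz: prob_space "J z" by fact
      have m: "(\<lambda>w. ennreal (norm (fst w))) \<in> borel_measurable (J z)" "(\<lambda>w. ennreal (norm (snd w))) \<in> borel_measurable (J z)"
        unfolding measurable_cong_sets[OF Jz(2) refl] by measurable
      have m1: "(\<lambda>v. ennreal (norm v)) \<in> borel_measurable (K (fst z))" "(\<lambda>v. ennreal (norm v)) \<in> borel_measurable (L (snd z))"
        unfolding measurable_cong_sets[OF Rx(2)[OF KN z(1)] refl] measurable_cong_sets[OF Rx(2)[OF LN z(2)] refl] by measurable
      have "(\<integral>\<^sup>+w. (ennreal (path_norm (Suc t) (fst (extend_pair t (z, w))) + path_norm (Suc t) (snd (extend_pair t (z, w))) + 1)
        * indicator {z. fst z \<noteq> snd z} (extend_pair t (z, w))) \<partial>J z)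
        \<le> (\<integral>\<^sup>+w. ennreal (?x + ?y + 1) + (ennreal (norm (fst w)) + ennreal (norm (snd w))) \<partial>J z)"
        by (intro nn_integral_mono)
           (auto simp: indicator_def extend_pair_def path_norm_extend path_norm_nonneg ac_simps simp flip: ennreal_plus)
      also have "\<dots> = ennreal (?x + ?y + 1) + ((\<integral>\<^sup>+w. ennreal (norm (fst w)) \<partial>J z) + (\<integral>\<^sup>+w. ennreal (norm (snd w)) \<partial>J z))"
        using m by (simp add: nn_integral_add Jz.emeasure_space_1)
      also have "\<dots> = ennreal (?x + ?y + 1) + ((\<integral>\<^sup>+v. ennreal (norm v) \<partial>K (fst z)) + (\<integral>\<^sup>+v. ennreal (norm v) \<partial>L (snd z)))"
        using nn_integral_Cpl(1)[OF JC[OF zN] m1(1)] nn_integral_Cpl(2)[OF JC[OF zN] m1(2)] by simp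
      also have "\<dots> \<le> ennreal (?x + ?y + 1) + (a * ennreal (?x + 1) + a * ennreal (?y + 1))"
        by (intro add_left_mono add_mono Kb Lb z)
      also have "\<dots> \<le> ennreal (?x + ?y + 1) + (a * ennreal (?x + ?y + 1) + a * ennreal (?x + ?y + 1))"
        by (intro add_left_mono add_mono mult_left_mono ennreal_leI) (auto simp: path_norm_nonneg)
      also have "\<dots> = (1 + 2 * a) * ennreal (?x + ?y + 1)" by (simp add: distrib_right mult_2)
      also have "\<dots> = ?E z + (1 + 2 * a) * ?D z" using False by simp
      finally show ?thesis .
    qed
  qed
  also have "\<dots> = (\<integral>\<^sup>+z. ?E z \<partial>\<pi>') + (1 + 2 * a) * off_diag_cost t \<pi>'"
    unfolding off_diag_cost_def using Em Dm by (simp add: nn_integral_add nn_integral_cmult)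
  also have "\<dots> \<le> ((1 + 2 * a) * off_diag_cost t \<pi>' + TV1 (Suc t) \<mu> \<nu>) + (1 + 2 * a) * off_diag_cost t \<pi>'"
    by (intro add_right_mono C_le)
  also have "\<dots> = 2 * (1 + 2 * a) * off_diag_cost t \<pi>' + TV1 (Suc t) \<mu> \<nu>"
  proof -
    have "X + V + X = 2 * X + V" for X V :: ennreal unfolding mult_2 by (simp only: ac_simps)
    then show ?thesis by (simp only: mult.assoc)
  qed
  finally show ?thesis by (rule that[OF \<pi>])
qed

section \<open>Induction over the time steps\<close>

lemma trunc_P1:
  fixes \<mu> :: "(nat \<Rightarrow> real ^ 'd) measure"
  assumes \<mu>: "\<mu> \<in> P1 (Suc t)"
  shows "trunc t \<mu> \<in> P1 t"
proof -
  note \<mu>D = P1_D[OF \<mu>]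
  have i: "init t \<in> \<mu> \<rightarrow>\<^sub>M paths t" using \<mu>D(1) by (simp cong: measurable_cong_sets)
  have "(\<integral>\<^sup>+x. ennreal (path_norm t x) \<partial>trunc t \<mu>) = (\<integral>\<^sup>+x. ennreal (path_norm t x) \<partial>\<mu>)"
    by (subst nn_integral_distr[OF i]) (simp_all add: path_norm_init)
  also have "\<dots> \<le> (\<integral>\<^sup>+x. ennreal (path_norm (Suc t) x) \<partial>\<mu>)"
    by (intro nn_integral_mono ennreal_leI) (simp add: path_norm_Suc)
  also note \<mu>D(4)
  finally show ?thesis
    using prob_space.prob_space_distr[OF \<mu>D(2) i] by (simp add: P1_def space_prob_algebra)
qed

lemma linear_cond_moments_trunc:
  assumes \<mu>: "\<mu> \<in> P1 (Suc t)" and l: "linear_cond_moments \<alpha> (Suc t) \<mu>"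
  shows "linear_cond_moments \<alpha> t (trunc t \<mu>)"
  unfolding linear_cond_moments_def
proof
  fix s assume s: "s \<in> {1..<t}"
  then have "s \<in> {1..<Suc t}" by simp
  with l obtain K where "is_kernel \<mu> s K"
    "\<forall>x\<in>space (paths s). (\<integral>\<^sup>+ v. ennreal (norm v) \<partial>K x) \<le> ennreal (\<alpha> * (path_norm s x + 1))"
    unfolding linear_cond_moments_def by blast
  then show "\<exists>K. is_kernel (trunc t \<mu>) s K \<and>
    (\<forall>x\<in>space (paths s). (\<integral>\<^sup>+ v. ennreal (norm v) \<partial>K x) \<le> ennreal (\<alpha> * (path_norm s x + 1)))"
    using s is_kernel_trunc[OF P1_D(1)[OF \<mu>], of s t] by auto
qed

text \<open>
  There is only one path of length \<open>0\<close>, so the conditional law given it is the unconditional one.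
\<close>

lemma is_kernel_0:
  fixes \<mu> :: "(nat \<Rightarrow> real ^ 'd) measure"
  assumes \<mu>: "\<mu> \<in> P1 (Suc 0)"
  shows "is_kernel \<mu> 0 (\<lambda>_. distr \<mu> borel (\<lambda>x. x 1))"
  unfolding is_kernel_def is_cond_law_def
proof (intro conjI ballI)
  note \<mu>D = P1_D[OF \<mu>]
  interpret prob_space \<mu> by (rule \<mu>D(2))
  show i: "init 0 \<in> \<mu> \<rightarrow>\<^sub>M paths 0" using \<mu>D(1) by (simp cong: measurable_cong_sets)
  have "(\<lambda>x. x 1) \<in> paths (Suc 0) \<rightarrow>\<^sub>M borel" by (rule measurable_coord) simp
  then have c: "(\<lambda>x. x 1) \<in> \<mu> \<rightarrow>\<^sub>M borel" using \<mu>D(1) by (simp cong: measurable_cong_sets)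
  then show "(\<lambda>x. x (0 + 1)) \<in> \<mu> \<rightarrow>\<^sub>M borel" by simp
  show "(\<lambda>_. distr \<mu> borel (\<lambda>x. x 1)) \<in> paths 0 \<rightarrow>\<^sub>M prob_algebra borel"
    using prob_space_distr[OF c] by (intro measurable_const) (simp add: space_prob_algebra)
  fix A :: "(nat \<Rightarrow> real ^ 'd) set" and B :: "(real ^ 'd) set"
  assume A: "A \<in> sets (paths 0)" and B: "B \<in> sets borel"
  have i0: "init 0 x = (\<lambda>_. undefined)" for x :: "nat \<Rightarrow> real ^ 'd" by (auto simp: init_def)
  have "(\<integral>\<^sup>+x. emeasure (distr \<mu> borel (\<lambda>x. x 1)) B * indicator A x \<partial>trunc 0 \<mu>)
    = (\<integral>\<^sup>+x. emeasure (distr \<mu> borel (\<lambda>x. x 1)) B * indicator A (\<lambda>_. undefined) \<partial>\<mu>)"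
    using A by (subst nn_integral_distr[OF i]) (auto simp: i0)
  also have "\<dots> = emeasure \<mu> {\<omega> \<in> space \<mu>. init 0 \<omega> \<in> A \<and> \<omega> (0 + 1) \<in> B}"
    using B by (cases "(\<lambda>_. undefined) \<in> A")
      (auto simp: i0 emeasure_distr[OF c[unfolded One_nat_def]] emeasure_space_1 intro!: arg_cong2[where f=emeasure])
  finally show "emeasure \<mu> {\<omega> \<in> space \<mu>. init 0 \<omega> \<in> A \<and> \<omega> (0 + 1) \<in> B}
    = (\<integral>\<^sup>+x. emeasure (distr \<mu> borel (\<lambda>x. x 1)) B * indicator A x \<partial>trunc 0 \<mu>)" by simp
qed

lemma off_diag_cost_0:
  assumes "\<pi> \<in> Cpl \<mu> \<nu>" "\<mu> \<in> P1 0" "\<nu> \<in> P1 0"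
  shows "off_diag_cost 0 \<pi> = 0"
proof -
  have "sets \<pi> = sets (paths 0 \<Otimes>\<^sub>M paths 0)"
    using assms(1) P1_D(1)[OF assms(2)] P1_D(1)[OF assms(3)]
    by (auto simp: Cpl_def space_prob_algebra cong: sets_pair_measure_cong)
  then have "space \<pi> = space (paths 0 \<Otimes>\<^sub>M paths 0)" by (rule sets_eq_imp_space_eq)
  then have "fst z = snd z" if "z \<in> space \<pi>" for z
    using that by (auto simp: space_pair_measure space_paths)
  then have "off_diag_cost 0 \<pi> = (\<integral>\<^sup>+z. 0 \<partial>\<pi>)"
    unfolding off_diag_cost_def by (intro nn_integral_cong) simp
  then show ?thesis by simp
qed

text \<open>
  With \<open>p = (3 + 4 \<alpha>)\<^sup>t\<close> the induction step amounts to \<open>(2 + 4 \<alpha>) (p - 1) + 1 \<le> (3 + 4 \<alpha>) p - 1\<close>, which is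
  \<open>0 \<le> p + 4 \<alpha>\<close>. Starting from the trivial coupling of paths of length \<open>0\<close> makes the first
  step an instance of the general one.
\<close>

lemma Cpl_bc_off_diag_cost_le:
  fixes \<mu> \<nu> :: "(nat \<Rightarrow> real ^ 'd) measure"
  assumes \<alpha>: "\<alpha> > 0" and "\<mu> \<in> P1 T" "\<nu> \<in> P1 T" "linear_cond_moments \<alpha> T \<mu>" "linear_cond_moments \<alpha> T \<nu>"
  shows "\<exists>\<pi>\<in>Cpl_bc T \<mu> \<nu>. off_diag_cost T \<pi> \<le> ennreal ((3 + 4 * \<alpha>) ^ T - 1) * TV1 T \<mu> \<nu>"
  using assms(2-)
proof (induction T arbitrary: \<mu> \<nu>)
  case 0
  have "\<mu> \<Otimes>\<^sub>M \<nu> \<in> Cpl \<mu> \<nu>" using P1_D(2)[OF 0(1)] P1_D(2)[OF 0(2)] by (rule Cpl_pair_measure)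
  then show ?case using off_diag_cost_0[OF _ 0(1,2)] by (auto simp: Cpl_bc_def intro!: bexI[of _ "\<mu> \<Otimes>\<^sub>M \<nu>"])
next
  case (Suc t)
  note \<mu> = Suc.prems(1) and \<nu> = Suc.prems(2)
  let ?V = "TV1 (Suc t) \<mu> \<nu>" and ?p = "(3 + 4 * \<alpha>) ^ t"
  have p: "1 \<le> ?p" using \<alpha> by (intro one_le_power) simp
  obtain \<pi>' where \<pi>': "\<pi>' \<in> Cpl_bc t (trunc t \<mu>) (trunc t \<nu>)"
    and le: "off_diag_cost t \<pi>' \<le> ennreal (?p - 1) * TV1 t (trunc t \<mu>) (trunc t \<nu>)"
    using Suc.IH[OF trunc_P1[OF \<mu>] trunc_P1[OF \<nu>] linear_cond_moments_trunc[OF \<mu> Suc.prems(3)]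
      linear_cond_moments_trunc[OF \<nu> Suc.prems(4)]] by blast
  show ?case
  proof (cases "t = 0")
    case True
    obtain \<pi> where \<pi>: "\<pi> \<in> Cpl_bc (Suc t) \<mu> \<nu>"
      and c: "off_diag_cost (Suc t) \<pi> \<le> 2 * (1 + 2 * \<top>) * off_diag_cost t \<pi>' + ?V"
      by (rule Cpl_bc_step[OF \<mu> \<nu> is_kernel_0[OF \<mu>[unfolded True], folded True] is_kernel_0[OF \<nu>[unfolded True], folded True], where a=\<top> and \<pi>'=\<pi>'])
         (use \<pi>' in \<open>auto simp: ennreal_top_mult path_norm_nonneg add_nonneg_pos not_le ennreal_eq_0_iff add_increasing add_pos_nonneg\<close>)
    \<comment> \<open>The factor \<open>\<infinity>\<close> is harmless because it multiplies \<open>0\<close>.\<close>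
    have "off_diag_cost t \<pi>' = 0"
      using \<pi>' trunc_P1[OF \<mu>] trunc_P1[OF \<nu>] True off_diag_cost_0 by (auto simp: Cpl_bc_def)
    then have "off_diag_cost (Suc t) \<pi> \<le> ?V" using c by simp
    also have "\<dots> \<le> ennreal ((3 + 4 * \<alpha>) ^ Suc t - 1) * ?V"
    proof -
      have "1 \<le> ennreal ((3 + 4 * \<alpha>) ^ Suc t - 1)"
        using True \<alpha> by (subst ennreal_1[symmetric], intro ennreal_leI) simp
      from mult_right_mono[OF this, of ?V] show ?thesis by simp
    qed
    finally show ?thesis using \<pi> by blast
  next
    case False
    then have t: "t \<in> {1..<Suc t}" by simp
    obtain K where K: "is_kernel \<mu> t K"
      and Kb: "\<forall>x\<in>space (paths t). (\<integral>\<^sup>+ v. ennreal (norm v) \<partial>K x) \<le> ennreal (\<alpha> * (path_norm t x + 1))"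
      using Suc.prems(3) t unfolding linear_cond_moments_def by blast
    obtain L where L: "is_kernel \<nu> t L"
      and Lb: "\<forall>x\<in>space (paths t). (\<integral>\<^sup>+ v. ennreal (norm v) \<partial>L x) \<le> ennreal (\<alpha> * (path_norm t x + 1))"
      using Suc.prems(4) t unfolding linear_cond_moments_def by blast
    have em: "ennreal (\<alpha> * (path_norm t x + 1)) = ennreal \<alpha> * ennreal (path_norm t x + 1)" for x :: "nat \<Rightarrow> real ^ 'd"
      using \<alpha> by (intro ennreal_mult') simp
    obtain \<pi> where \<pi>: "\<pi> \<in> Cpl_bc (Suc t) \<mu> \<nu>"
      and c: "off_diag_cost (Suc t) \<pi> \<le> 2 * (1 + 2 * ennreal \<alpha>) * off_diag_cost t \<pi>' + ?V"
      by (rule Cpl_bc_step[OF \<mu> \<nu> K L _ _ \<pi>', where a="ennreal \<alpha>"]) (use Kb Lb in \<open>auto simp: em\<close>)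
    have two: "2 * (1 + 2 * ennreal \<alpha>) = ennreal (2 + 4 * \<alpha>)"
    proof -
      have "ennreal (2 * (1 + 2 * \<alpha>)) = 2 * (1 + 2 * ennreal \<alpha>)"
        using \<alpha> by (subst ennreal_mult', simp, subst ennreal_plus, simp, simp, subst ennreal_mult', simp, simp)
      then show ?thesis by (simp add: algebra_simps)
    qed
    have "off_diag_cost (Suc t) \<pi> \<le> ennreal (2 + 4 * \<alpha>) * (ennreal (?p - 1) * ?V) + ?V"
      using c unfolding two
      by (rule order_trans) (intro add_right_mono mult_left_mono order_trans[OF le] TV1_init_le[OF \<mu> \<nu>], simp_all)
    also have "\<dots> = ennreal ((2 + 4 * \<alpha>) * (?p - 1) + 1) * ?V"
    proof -
      have "ennreal (b * q + 1) = ennreal b * ennreal q + 1" if "0 \<le> b" "0 \<le> q" for b q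
        using that by (simp add: ennreal_mult)
      from this[of "2 + 4 * \<alpha>" "?p - 1"] show ?thesis
        using \<alpha> p by (simp only: distrib_right mult.assoc mult_1)
    qed
    also have "\<dots> \<le> ennreal ((3 + 4 * \<alpha>) ^ Suc t - 1) * ?V"
      using p \<alpha> by (intro mult_right_mono ennreal_leI) (simp_all add: algebra_simps)
    finally show ?thesis using \<pi> by blast
  qed
qed

lemma path_dist_le: "path_dist t x y \<le> path_norm t x + path_norm t y"
  unfolding path_dist_def path_norm_def sum.distrib[symmetric]
  by (intro sum_mono norm_triangle_ineq4)

theorem theorem3p6:
  fixes T :: nat and \<alpha> :: real and \<mu> \<nu> :: "(nat \<Rightarrow> real ^ 'd) measure"
  assumes "T \<ge> 1"
    and "\<alpha> > 0"
    and "\<mu> \<in> P1 T" and "\<nu> \<in> P1 T"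
    and "linear_cond_moments \<alpha> T \<mu>" and "linear_cond_moments \<alpha> T \<nu>"
  shows "AW1 T \<mu> \<nu> \<le> ennreal ((3 + 4 * \<alpha>) ^ T - 1) * TV1 T \<mu> \<nu>"
proof -
  obtain \<pi> where \<pi>: "\<pi> \<in> Cpl_bc T \<mu> \<nu>"
    and le: "off_diag_cost T \<pi> \<le> ennreal ((3 + 4 * \<alpha>) ^ T - 1) * TV1 T \<mu> \<nu>"
    using Cpl_bc_off_diag_cost_le[OF assms(2-)] by blast
  have "AW1 T \<mu> \<nu> \<le> (\<integral>\<^sup>+ (x, y). ennreal (path_dist T x y) \<partial>\<pi>)"
    unfolding AW1_def by (rule INF_lower[OF \<pi>])
  also have "\<dots> \<le> off_diag_cost T \<pi>"
    unfolding off_diag_cost_def split_beta'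
  proof (rule nn_integral_mono)
    fix z :: "(nat \<Rightarrow> real ^ 'd) \<times> (nat \<Rightarrow> real ^ 'd)"
    have "path_dist T (fst z) (snd z) = 0" if "fst z = snd z"
      using that by (simp add: path_dist_def path_norm_def)
    moreover have "path_dist T (fst z) (snd z) \<le> path_norm T (fst z) + path_norm T (snd z) + 1"
      using path_dist_le[of T "fst z" "snd z"] by simp
    ultimately show "ennreal (path_dist T (fst z) (snd z))
        \<le> ennreal (path_norm T (fst z) + path_norm T (snd z) + 1) * indicator {z. fst z \<noteq> snd z} z"
      by (auto simp: indicator_def intro: ennreal_leI)
  qed
  also note le
  finally show ?thesis .
qed

end
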